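(* Consider the SEA model (see context) on $\mathcal{X}\subseteq\mathbb{R}^d$ with horizon $T$. Assume there are constants $G,D,L,\alpha>0$ such that: (i) $\max_{\mathbf{x}\in\mathcal{X}}\|\nabla f_t(\mathbf{x})\|_2\le G$ for every individual function $f_t$, $t\in[T]$; (ii) $\mathbf{0}\in\mathcal{X}$ and $\|\mathbf{x}-\mathbf{y}\|_2\le D$ for all $\mathbf{x},\mathbf{y}\in\mathcal{X}$; (iii) every expected function $F_t$ is $L$-smooth on $\mathcal{X}$, i.e. $\|\nabla F_t(\mathbf{x})-\nabla F_t(\mathbf{y})\|_2\le L\|\mathbf{x}-\mathbf{y}\|_2$ for all $\mathbf x,\mathbf y\in\mathcal X$; (iv) every individual function $f_t$ is $\alpha$-exp-concave on $\mathcal{X}$ (i.e. $\exp(-\alpha f_t)$ is concave on $\mathcal X$). Let $\beta=\frac12\min\{\frac1{4GD},\alpha\}$ and $H_t=I+\frac\beta2G^2I+\frac\beta2\sum_{s=1}^{t-1}\nabla f_s(\mathbf{x}_s)\nabla f_s(\mathbf{x}_s)^\top$, where $I$ is the $d\times d$ identity matrix and $\|\mathbf v\|_{H}^2=\mathbf v^\top H\mathbf v$. Let $\mathbf{x}_1=\hat{\mathbf{x}}_1$ be any point of $\mathcal{X}$, and run $$\hat{\mathbf{x}}_{t+1}=\arg\min_{\mathbf{x}\in\mathcal{X}}\langle\nabla f_t(\mathbf{x}_t),\mathbf{x}\rangle+\tfrac12\|\mathbf{x}-\hat{\mathbf{x}}_t\|_{H_t}^2,\qquad \mathbf{x}_{t+1}=\arg\min_{\mathbf{x}\in\mathcal{X}}\langle\nabla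 f_t(\mathbf{x}_t),\mathbf{x}\rangle+\tfrac12\|\mathbf{x}-\hat{\mathbf{x}}_{t+1}\|_{H_{t+1}}^2.$$ Then for every fixed $\mathbf{u}\in\mathcal{X}$, $$\mathbb{E}\Big[\sum_{t=1}^T f_t(\mathbf{x}_t)-\sum_{t=1}^T f_t(\mathbf{u})\Big]\le\frac{16d}{\beta}\ln\Big(\frac\beta d\sigma_{1:T}^2+\frac{\beta}{2d}\Sigma_{1:T}^2+\frac{\beta}{8d}G^2+1\Big)+\frac{16d}{\beta}\ln(32L^2+1)+D^2\Big(1+\frac\beta2G^2\Big).$$ In particular the expected regret is $\mathcal{O}\big(\frac d\alpha\log(\sigma_{1:T}^2+\Sigma_{1:T}^2)\big)$.
   Context: SEA (Stochastically Extended Adversarial) model: $d,T\ge1$, $[T]=\{1,\dots,T\}$, and $\mathcal{X}\subseteq\mathbb{R}^d$ is a nonempty closed convex feasible domain. In each round $t\in[T]$ the learner selects $\mathbf{x}_t\in\mathcal{X}$ based on the previously observed functions $f_1,\dots,f_{t-1}$; nature chooses a distribution $\mathfrak{D}_t$ over differentiable functions $\mathcal{X}\to\mathbb{R}$ (possibly random, depending on the past); then the individual (random) function $f_t$ is sampled from $\mathfrak{D}_t$ (i.e. conditionally on the past and on $\mathfrak{D}_t$, $f_t$ has law $\mathfrak{D}_t$), the learner suffers $f_t(\mathbf{x}_t)$ and observes $f_t$. The (conditional) expected function is $F_t(\mathbf{x})=\mathbb{E}_{f_t\sim\mathfrak{D}_t}[f_t(\mathbf{x})]$, and differentiation and expectation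 may be interchanged: $\nabla F_t(\mathbf{x})=\mathbb{E}_{f_t\sim\mathfrak{D}_t}[\nabla f_t(\mathbf{x})]$. Define $$\sigma_t^2=\sup_{\mathbf{x}\in\mathcal{X}}\mathbb{E}_{f_t\sim\mathfrak{D}_t}\big[\|\nabla f_t(\mathbf{x})-\nabla F_t(\mathbf{x})\|_2^2\big],\quad \sigma_{1:T}^2=\mathbb{E}\Big[\sum_{t=1}^T\sigma_t^2\Big],\quad \Sigma_{1:T}^2=\mathbb{E}\Big[\sum_{t=1}^T\sup_{\mathbf{x}\in\mathcal{X}}\|\nabla F_t(\mathbf{x})-\nabla F_{t-1}(\mathbf{x})\|_2^2\Big],$$ with $\nabla F_0\equiv\mathbf 0$. The $\mathcal{O}$-notation means: bounded by $C\frac d\alpha\big(1+\log(1+\sigma_{1:T}^2+\Sigma_{1:T}^2)\big)$ with $C$ depending only on $D,G,L,\alpha$ (not on $T$ or $d$). *)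

theory Defs
  imports "HOL-Probability.Probability"
begin

section \<open>Stochastically extended adversarial online optimisation\<close>

text \<open>
  Loss functions are total functions on \<open>real ^ 'd\<close>; only their restriction to the feasible domain
  \<open>X\<close> matters, so gradients are taken within \<open>X\<close>. If \<open>X\<close> has empty interior, such a gradient is
  not unique. Gradients are therefore given by an operator \<open>grad\<close>, which is a parameter
  throughout and may be any choice of gradients within \<open>X\<close>.
\<close>

definition gradient_on ::
    "(real ^ 'd) set \<Rightarrow> ((real ^ 'd \<Rightarrow> real) \<Rightarrow> real ^ 'd \<Rightarrow> real ^ 'd) \<Rightarrow> (real ^ 'd \<Rightarrow> real) \<Rightarrow> bool"
  where "gradient_on X grad h \<longleftrightarrow>
    (\<forall>x\<in>X. (h has_derivative (\<lambda>v. grad h x \<bullet> v)) (at x within X))"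

definition exp_concave_on :: "real \<Rightarrow> (real ^ 'd) set \<Rightarrow> (real ^ 'd \<Rightarrow> real) \<Rightarrow> bool"
  where "exp_concave_on \<alpha> X h \<longleftrightarrow> concave_on X (\<lambda>x. exp (- \<alpha> * h x))"

definition mean_fun :: "(real ^ 'd \<Rightarrow> real) measure \<Rightarrow> real ^ 'd \<Rightarrow> real"
  where "mean_fun P x = (\<integral>h. h x \<partial>P)"

text \<open>The gradient of the expected function of round \<open>t\<close>, with value \<open>0\<close> in round \<open>0\<close>.\<close>

definition mean_grad ::
    "((real ^ 'd \<Rightarrow> real) \<Rightarrow> real ^ 'd \<Rightarrow> real ^ 'd)
     \<Rightarrow> (nat \<Rightarrow> 'w \<Rightarrow> (real ^ 'd \<Rightarrow> real) measure) \<Rightarrow> nat \<Rightarrow> 'w \<Rightarrow> real ^ 'd \<Rightarrow> real ^ 'd"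
  where "mean_grad grad \<DD> t \<omega> x = (if t = 0 then 0 else grad (mean_fun (\<DD> t \<omega>)) x)"

definition grad_variance ::
    "(real ^ 'd) set \<Rightarrow> ((real ^ 'd \<Rightarrow> real) \<Rightarrow> real ^ 'd \<Rightarrow> real ^ 'd)
     \<Rightarrow> (nat \<Rightarrow> 'w \<Rightarrow> (real ^ 'd \<Rightarrow> real) measure) \<Rightarrow> nat \<Rightarrow> 'w \<Rightarrow> real"
  where "grad_variance X grad \<DD> t \<omega> =
    (SUP x\<in>X. \<integral>h. (norm (grad h x - mean_grad grad \<DD> t \<omega> x))\<^sup>2 \<partial>(\<DD> t \<omega>))"

definition grad_variation ::
    "(real ^ 'd) set \<Rightarrow> ((real ^ 'd \<Rightarrow> real) \<Rightarrow> real ^ 'd \<Rightarrow> real ^ 'd)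
     \<Rightarrow> (nat \<Rightarrow> 'w \<Rightarrow> (real ^ 'd \<Rightarrow> real) measure) \<Rightarrow> nat \<Rightarrow> 'w \<Rightarrow> real"
  where "grad_variation X grad \<DD> t \<omega> =
    (SUP x\<in>X. (norm (mean_grad grad \<DD> t \<omega> x - mean_grad grad \<DD> (t - 1) \<omega> x))\<^sup>2)"

text \<open>The cumulative quantities $\sigma_{1:T}^2$ and $\Sigma_{1:T}^2$.\<close>

definition cum_variance ::
    "'w measure \<Rightarrow> nat \<Rightarrow> (real ^ 'd) set \<Rightarrow> ((real ^ 'd \<Rightarrow> real) \<Rightarrow> real ^ 'd \<Rightarrow> real ^ 'd)
     \<Rightarrow> (nat \<Rightarrow> 'w \<Rightarrow> (real ^ 'd \<Rightarrow> real) measure) \<Rightarrow> real"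
  where "cum_variance M T X grad \<DD> = (\<integral>\<omega>. (\<Sum>t=1..T. grad_variance X grad \<DD> t \<omega>) \<partial>M)"

definition cum_variation ::
    "'w measure \<Rightarrow> nat \<Rightarrow> (real ^ 'd) set \<Rightarrow> ((real ^ 'd \<Rightarrow> real) \<Rightarrow> real ^ 'd \<Rightarrow> real ^ 'd)
     \<Rightarrow> (nat \<Rightarrow> 'w \<Rightarrow> (real ^ 'd \<Rightarrow> real) measure) \<Rightarrow> real"
  where "cum_variation M T X grad \<DD> = (\<integral>\<omega>. (\<Sum>t=1..T. grad_variation X grad \<DD> t \<omega>) \<partial>M)"

text \<open>
  The information available when the loss of round \<open>t\<close> is drawn: the losses of the earlier rounds
  and the distributions of all rounds up to and including \<open>t\<close>.
\<close>

definition past ::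
    "'w measure \<Rightarrow> (real ^ 'd \<Rightarrow> real) measure
     \<Rightarrow> (nat \<Rightarrow> 'w \<Rightarrow> (real ^ 'd \<Rightarrow> real) measure) \<Rightarrow> (nat \<Rightarrow> 'w \<Rightarrow> real ^ 'd \<Rightarrow> real) \<Rightarrow> nat \<Rightarrow> 'w measure"
  where "past M N \<DD> f t = sigma (space M)
    ((\<Union>s\<in>{1..<t}. {f s -` A \<inter> space M | A. A \<in> sets N}) \<union>
     (\<Union>s\<in>{1..t}. {\<DD> s -` B \<inter> space M | B. B \<in> sets (prob_algebra N)}))"

text \<open>
  \<open>N\<close> is the measurable space from which the losses are drawn. It consists of differentiable
  functions and carries any sigma-algebra for which evaluation and gradient are measurable.
  The suprema over the uncountable set \<open>X\<close> need not be measurable in general; the last two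
  assumptions express that they are random variables, so that their expectations make sense.
\<close>

locale sea_model = prob_space M for M :: "'w measure" +
  fixes T :: nat
    and X :: "(real ^ 'd) set"
    and N :: "(real ^ 'd \<Rightarrow> real) measure"
    and grad :: "(real ^ 'd \<Rightarrow> real) \<Rightarrow> real ^ 'd \<Rightarrow> real ^ 'd"
    and \<DD> :: "nat \<Rightarrow> 'w \<Rightarrow> (real ^ 'd \<Rightarrow> real) measure"
    and f :: "nat \<Rightarrow> 'w \<Rightarrow> real ^ 'd \<Rightarrow> real"
  assumes horizon: "T \<ge> 1"
    and domain: "X \<noteq> {}" "closed X" "convex X"
    and loss_gradient: "\<And>h. h \<in> space N \<Longrightarrow> gradient_on X grad h"
    and eval_measurable:
      "(\<lambda>(h, x). h x) \<in> N \<Otimes>\<^sub>M restrict_space borel X \<rightarrow>\<^sub>M borel"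
    and grad_measurable:
      "(\<lambda>(h, x). grad h x) \<in> N \<Otimes>\<^sub>M restrict_space borel X \<rightarrow>\<^sub>M borel"
    and distribution_measurable: "\<And>t. t \<in> {1..T} \<Longrightarrow> \<DD> t \<in> M \<rightarrow>\<^sub>M prob_algebra N"
    and loss_measurable: "\<And>t. t \<in> {1..T} \<Longrightarrow> f t \<in> M \<rightarrow>\<^sub>M N"
    and conditional_law: "\<And>t A. t \<in> {1..T} \<Longrightarrow> A \<in> sets N \<Longrightarrow>
      AE \<omega> in M. real_cond_exp M (past M N \<DD> f t) (\<lambda>\<omega>. indicator A (f t \<omega>)) \<omega> = measure (\<DD> t \<omega>) A"
    and loss_integrable: "\<And>t \<omega> x. t \<in> {1..T} \<Longrightarrow> \<omega> \<in> space M \<Longrightarrow> x \<in> X \<Longrightarrow>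
      integrable (\<DD> t \<omega>) (\<lambda>h. h x)"
    and grad_integrable: "\<And>t \<omega> x. t \<in> {1..T} \<Longrightarrow> \<omega> \<in> space M \<Longrightarrow> x \<in> X \<Longrightarrow>
      integrable (\<DD> t \<omega>) (\<lambda>h. grad h x)"
    and mean_gradient: "\<And>t \<omega>. t \<in> {1..T} \<Longrightarrow> \<omega> \<in> space M \<Longrightarrow>
      gradient_on X grad (mean_fun (\<DD> t \<omega>))"
    and interchange: "\<And>t \<omega> x. t \<in> {1..T} \<Longrightarrow> \<omega> \<in> space M \<Longrightarrow> x \<in> X \<Longrightarrow>
      grad (mean_fun (\<DD> t \<omega>)) x = (\<integral>h. grad h x \<partial>(\<DD> t \<omega>))"
    and variance_measurable: "\<And>t. t \<in> {1..T} \<Longrightarrow> grad_variance X grad \<DD> t \<in> borel_measurable M"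
    and variation_measurable: "\<And>t. t \<in> {1..T} \<Longrightarrow> grad_variation X grad \<DD> t \<in> borel_measurable M"


section \<open>Optimistic online mirror descent for exp-concave losses\<close>

definition outer_square :: "real ^ 'd \<Rightarrow> real ^ 'd ^ 'd"
  where "outer_square v = (\<chi> i j. v $ i * v $ j)"

definition mat_norm_sq :: "real ^ 'd ^ 'd \<Rightarrow> real ^ 'd \<Rightarrow> real"
  where "mat_norm_sq H v = v \<bullet> (H *v v)"

definition beta_of :: "real \<Rightarrow> real \<Rightarrow> real \<Rightarrow> real"
  where "beta_of D G \<alpha> = 1 / 2 * min (1 / (4 * G * D)) \<alpha>"

text \<open>The matrix $H_t$, as a function of the observed gradients \<open>g s\<close> for \<open>1 \<le> s < t\<close>.\<close>

definition oomd_matrix :: "real \<Rightarrow> real \<Rightarrow> (nat \<Rightarrow> real ^ 'd) \<Rightarrow> nat \<Rightarrow> real ^ 'd ^ 'd"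
  where "oomd_matrix \<beta> G g t =
    mat 1 + (\<beta> / 2 * G\<^sup>2) *\<^sub>R mat 1 + (\<beta> / 2) *\<^sub>R (\<Sum>s\<in>{1..<t}. outer_square (g s))"

definition oomd_objective ::
    "real ^ 'd \<Rightarrow> real ^ 'd ^ 'd \<Rightarrow> real ^ 'd \<Rightarrow> real ^ 'd \<Rightarrow> real"
  where "oomd_objective g H c z = g \<bullet> z + 1 / 2 * mat_norm_sq H (z - c)"

text \<open>
  One realisation of the algorithm on the losses \<open>l 1, \<dots>, l T\<close>: \<open>x t\<close> is the decision of round
  \<open>t\<close> and \<open>xh t\<close> the auxiliary iterate.
\<close>

definition oomd_run ::
    "nat \<Rightarrow> (real ^ 'd) set \<Rightarrow> ((real ^ 'd \<Rightarrow> real) \<Rightarrow> real ^ 'd \<Rightarrow> real ^ 'd) \<Rightarrow> real \<Rightarrow> real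
     \<Rightarrow> real ^ 'd \<Rightarrow> (nat \<Rightarrow> real ^ 'd \<Rightarrow> real) \<Rightarrow> (nat \<Rightarrow> real ^ 'd) \<Rightarrow> (nat \<Rightarrow> real ^ 'd) \<Rightarrow> bool"
  where "oomd_run T X grad \<beta> G x1 l x xh \<longleftrightarrow>
    (let g = (\<lambda>t. grad (l t) (x t)); H = oomd_matrix \<beta> G g in
     x 1 = x1 \<and> xh 1 = x1 \<and>
     (\<forall>t\<in>{1..T}.
        is_arg_min (oomd_objective (g t) (H t) (xh t)) (\<lambda>z. z \<in> X) (xh (t + 1)) \<and>
        is_arg_min (oomd_objective (g t) (H (t + 1)) (xh (t + 1))) (\<lambda>z. z \<in> X) (x (t + 1))))"

text \<open>
  The constant hidden in the asymptotic form of the bound. A dimension that is a type cannot be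
  quantified inside a formula, so an existentially quantified constant could depend on the
  dimension. An explicit constant, defined without reference to the dimension or the horizon,
  makes the uniformity in both manifest. Its value is obtained from the non-asymptotic bound, for
  any $d \ge 1$ and $S = \sigma_{1:T}^2 + \Sigma_{1:T}^2$, through
  $\ln(\beta S/d + \beta G^2/(8d) + 1) \le \ln(1 + \beta + \beta G^2/8) + \ln(1 + S)$.
\<close>

definition regret_const :: "real \<Rightarrow> real \<Rightarrow> real \<Rightarrow> real \<Rightarrow> real"
  where "regret_const D G L \<alpha> = (let \<beta> = beta_of D G \<alpha> in
    16 * \<alpha> / \<beta> * (1 + ln (1 + \<beta> + \<beta> / 8 * G\<^sup>2) + ln (32 * L\<^sup>2 + 1))
    + \<alpha> * D\<^sup>2 * (1 + \<beta> / 2 * G\<^sup>2))"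

end

theory Submission
  imports Defs
begin

text \<open>The potential is that of \<open>A_t\<close> and not of \<open>H_t\<close> so that the
  logarithm sees the sum of the squared norms of the \<open>v_t\<close>, which can stay small while
  that of the \<open>g_t\<close> grows linearly in T. \<open>A_t\<close> contains round t although
  \<open>H_t\<close> stops at round t - 1; the summand \<open>\<beta>/2 * G^2 * I\<close> of
  \<open>H_t\<close> pays for the missing round. The factor 2 in front of the potential has two
  sources: the error of the prediction \<open>g_{t-1}\<close>, and the cost of moving the quadratic
  gain from \<open>x_t\<close> to the next auxiliary iterate. The constant 32 L^2 + 1 is the point
  where the tangent of the logarithm has slope below 1/(32 L^2); multiplied by 16 d/\<beta> this is
  exactly what the movement term with coefficient 1/4 can absorb. On the probabilistic side the
  iterates are known only as pointwise minimisers, so their measurability has to be derived from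
  uniqueness, and the conditional law is known for one event at a time, so it must be extended to
  functions of the loss and the decision jointly. Jensen's inequality is applied as a pathwise
  tangent bound, which needs expectations of linear expressions only.\<close>

text \<open>
  Write $g_t = \nabla f_t(x_t)$ and $v_t = g_t - g_{t-1}$ with $g_0 = 0$. Exp-concavity gives
  $f_t(x_t) - f_t(u) \le \langle g_t, x_t - u\rangle - \frac\beta2 \langle g_t, x_t - u\rangle^2$,
  and the quadratic term absorbs the growth of $H_t$ in the telescoping sum of mirror descent. What
  remains is $2\sum_t \|v_t\|^2_{A_t^{-1}} - \frac14\sum_t\|x_t - x_{t-1}\|^2$, where
  $A_t = I + \frac\beta8\sum_{s\le t} v_s v_s^\top \preceq H_t$. A determinant argument bounds the first
  sum by a logarithm of $\sum_t \|v_t\|^2$, which splits into gradient noise, gradient variation and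
  $4L^2\sum_t\|x_t - x_{t-1}\|^2$; the last part is paid for by the negative term.
  The decision $x_t$ is measurable with respect to the past, so the expected noise at $x_t$ is at most
  the expectation of $\sigma_t^2$, and Jensen's inequality for the logarithm finishes the proof.
\<close>

section \<open>Determinants and the elliptical potential\<close>

text \<open>Row operations with one pivot row. Since \<open>k\<close> lies outside \<open>S\<close>,
  the pivot is never altered, so the rows can be treated one after another.\<close>

lemma det_add_multiples_of_row:
  fixes A :: "real ^ 'n ^ 'n" and c :: "'n \<Rightarrow> real"
  assumes "k \<notin> S"
  shows "det (\<chi> i. if i \<in> S then row i A + c i *s row k A else row i A) = det A"
proof -
  have "finite S" by simp
  then show ?thesis using assms
  proof (induction S)
    case empty
    have "(\<chi> i. row i A) = A" by (simp add: row_def vec_eq_iff)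
    then show ?case by simp
  next
    case (insert j S)
    let ?B = "\<chi> i. if i \<in> S then row i A + c i *s row k A else row i A"
    have "(\<chi> i. if i \<in> insert j S then row i A + c i *s row k A else row i A)
        = (\<chi> i. if i = j then row j ?B + c j *s row k ?B else row i ?B)"
      using insert by (auto simp: vec_eq_iff row_def)
    moreover have "j \<noteq> k" using insert by auto
    ultimately show ?case using insert det_row_operation[of j k ?B "c j"] by simp
  qed
qed

text \<open>Multilinear expansion in the rows. A term that uses \<open>v\<close> in two rows
  vanishes, which leaves the terms with at most one replaced row.\<close>

lemma det_add_rank_one:
  fixes A :: "real ^ 'n ^ 'n" and u v :: "real ^ 'n"
  shows "det (\<chi> i. A $ i + u $ i *s v)
    = det A + (\<Sum>k\<in>UNIV. u $ k * det (\<chi> i. if i = k then v else A $ i))"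
proof -
  have "finite S \<Longrightarrow> det (\<chi> i. if i \<in> S then A $ i + u $ i *s v else A $ i)
    = det A + (\<Sum>k\<in>S. u $ k * det (\<chi> i. if i = k then v else A $ i))" for S :: "'n set"
  proof (induction S rule: finite_induct)
    case empty
    then show ?case by simp
  next
    case (insert k S)
    let ?R = "\<lambda>i. if i \<in> S then A $ i + u $ i *s v else A $ i"
    let ?K = "\<chi> i. if i = k then v else A $ i"
    have "det (\<chi> i. if i \<in> insert k S then A $ i + u $ i *s v else A $ i)
        = det (\<chi> i. if i = k then A $ i + u $ i *s v else ?R i)"
      by (rule arg_cong[where f=det]) (auto simp: vec_eq_iff)
    also have "\<dots> = det (\<chi> i. if i = k then A $ i else ?R i) + u $ k * det (\<chi> i. if i = k then v else ?R i)"
      using det_row_add[of k "\<lambda>i. A $ i" "\<lambda>i. u $ i *s v" ?R] det_row_mul[of k "u $ k" "\<lambda>i. v" ?R]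
      by (smt (verit, best) Cart_lambda_cong)
    also have "(\<chi> i. if i = k then A $ i else ?R i) = (\<chi> i. ?R i)"
      using insert by (auto simp: vec_eq_iff)
    \<comment> \<open>With \<open>v\<close> standing in row \<open>k\<close>, the summands
      \<open>u $ i *s v\<close> in the rows of \<open>S\<close> are multiples of that row and can be
      removed.\<close>
    also have "det (\<chi> i. if i = k then v else ?R i)
        = det (\<chi> i. if i \<in> S then row i ?K + u $ i *s row k ?K else row i ?K)"
      using insert by (intro arg_cong[where f=det]) (auto simp: vec_eq_iff row_def)
    also have "\<dots> = det ?K" using insert by (intro det_add_multiples_of_row) auto
    finally show ?case using insert by simp
  qed
  from this[of UNIV] show ?thesis by simp
qed

text \<open>The matrix determinant lemma at the identity. Cramer's rule evaluates the identity with
  row \<open>k\<close> replaced by \<open>v\<close> to \<open>v $ k\<close>.\<close>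

lemma det_one_add_rank_one:
  fixes u v :: "real ^ 'n"
  shows "det (\<chi> i j. (if i = j then 1 else 0) + u $ i * v $ j) = 1 + u \<bullet> v"
proof -
  have "det (\<chi> i. if i = k then v else (mat 1 :: real^'n^'n) $ i) = v $ k" for k
  proof -
    have "row i (mat 1 :: real^'n^'n) = axis i 1" "(mat 1 :: real^'n^'n) $ i = axis i 1" for i
      by (auto simp: row_def mat_def axis_def vec_eq_iff)
    then show ?thesis
      using cramer_lemma_transpose[where x=v and A="mat 1 :: real^'n^'n" and k=k]
      by (simp only: basis_expansion det_I mult_1_right)
  qed
  moreover have "(\<chi> i j. (if i = j then 1 else 0) + u $ i * v $ j) = (\<chi> i. (mat 1 :: real^'n^'n) $ i + u $ i *s v)"
    by (simp add: vec_eq_iff mat_def)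
  ultimately show ?thesis
    using det_add_rank_one[where A="mat 1 :: real^'n^'n" and u=u and v=v]
    by (simp add: inner_vec_def)
qed

text \<open>Symmetry is part of the notion: over the reals it does not follow from positivity of the
  quadratic form, and the elimination below relies on it.\<close>

definition pos_def :: "real ^ 'n ^ 'n \<Rightarrow> bool"
  where "pos_def A \<longleftrightarrow> transpose A = A \<and> (\<forall>x. x \<noteq> 0 \<longrightarrow> 0 < x \<bullet> (A *v x))"

lemma inner_axis_matrix_axis:
  fixes A :: "real ^ 'n ^ 'n"
  shows "axis i 1 \<bullet> (A *v axis i 1) = A $ i $ i"
  by (simp add: inner_axis' matrix_vector_mul_component inner_axis)

lemma pos_def_diagonal_pos: "pos_def A \<Longrightarrow> 0 < A $ i $ i"
  using inner_axis_matrix_axis[of i A] unfolding pos_def_def by (metis axis_eq_0_iff zero_neq_one)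

text \<open>Symmetric elimination of one row and column at a time; each step is a congruence by a
  matrix of determinant 1 and does not increase the diagonal.\<close>

lemma pos_def_hadamard_aux:
  fixes A :: "real ^ 'n ^ 'n" and S :: "'n set"
  assumes "finite S" "pos_def A" "\<And>i j. i \<notin> S \<Longrightarrow> i \<noteq> j \<Longrightarrow> A $ i $ j = 0"
  shows "0 < det A \<and> det A \<le> (\<Prod>i\<in>UNIV. A $ i $ i)"
  using assms
proof (induction S arbitrary: A rule: finite_induct)
  case empty
  then have "det A = (\<Prod>i\<in>UNIV. A $ i $ i)" by (intro det_diagonal) auto
  then show ?case using pos_def_diagonal_pos[OF empty(1)] by (simp add: prod_pos)
next
  case (insert k S)
  note dp = pos_def_diagonal_pos[OF insert.prems(1)]
  have sym: "A $ i $ j = A $ j $ i" for i j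
    using insert.prems(1) unfolding pos_def_def by (metis transpose_def vec_lambda_beta)
  \<comment> \<open>These are the Gauss multipliers that clear column \<open>k\<close> in the rows
    of \<open>S\<close>, the rows that may still have off-diagonal entries. \<open>E\<close> is the
    identity minus \<open>u\<close> times the transposed \<open>k\<close>-th unit vector, and
    \<open>B\<close> performs the operation on rows and columns alike.\<close>
  define u :: "real ^ 'n" where "u = (\<chi> i. if i \<in> S then A $ i $ k / A $ k $ k else 0)"
  have uk: "u $ k = 0" using insert.hyps by (simp add: u_def)
  define E :: "real ^ 'n ^ 'n" where
    "E = (\<chi> i j. (if i = j then 1 else 0) + (- u) $ i * axis k 1 $ j)"
  have detE: "det E = 1"
    unfolding E_def det_one_add_rank_one by (simp add: inner_axis uk)
  define B where "B = E ** A ** transpose E"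
  have EA: "(E ** A) $ i $ j = A $ i $ j - u $ i * A $ k $ j" for i j
    by (simp add: E_def matrix_matrix_mult_def axis_def algebra_simps sum.distrib sum_subtractf
        if_distrib[of "\<lambda>z. _ * z"] cong: if_cong)
  have B: "B $ i $ j = A $ i $ j - u $ i * A $ k $ j - (A $ i $ k - u $ i * A $ k $ k) * u $ j" for i j
  proof -
    have "B $ i $ j = (\<Sum>l\<in>UNIV. (E ** A) $ i $ l * E $ j $ l)"
      by (simp add: B_def matrix_matrix_mult_def[of "E ** A"] transpose_def)
    then show ?thesis unfolding EA
      by (simp add: E_def axis_def algebra_simps sum.distrib sum_subtractf
        if_distrib[of "\<lambda>z. _ * z"] cong: if_cong)
  qed
  have "det B = det A" by (simp add: B_def det_mul detE)
  moreover have "B $ i $ i \<le> A $ i $ i" for i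
  proof (cases "i \<in> S")
    case True
    \<comment> \<open>The diagonal of the Schur complement, where symmetry turns the correction into
      a square.\<close>
    then have "B $ i $ i = A $ i $ i - (A $ i $ k)\<^sup>2 / A $ k $ k"
      using dp[of k] unfolding B by (simp add: u_def sym[of k i] field_simps power2_eq_square)
    then show ?thesis using dp[of k] by simp
  next
    case False
    then show ?thesis unfolding B by (simp add: u_def)
  qed
  moreover have "pos_def B"
  proof -
    have "transpose B = B"
      using insert.prems(1) by (simp add: B_def matrix_transpose_mul matrix_mul_assoc pos_def_def)
    moreover have "0 < x \<bullet> (B *v x)" if "x \<noteq> 0" for x
    proof -
      let ?y = "transpose E *v x"
      have "x \<bullet> (B *v x) = ?y \<bullet> (A *v ?y)"
        unfolding B_def matrix_vector_mul_assoc[symmetric]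
        by (metis dot_lmul_matrix transpose_matrix_vector)
      moreover have "?y \<noteq> 0"
      proof -
        have "invertible (transpose E)" by (simp add: invertible_det_nz detE)
        then show ?thesis using that
          by (meson invertible_def matrix_left_invertible_ker)
      qed
      ultimately show ?thesis using insert.prems(1) by (simp add: pos_def_def)
    qed
    ultimately show ?thesis by (simp add: pos_def_def)
  qed
  moreover have "B $ i $ j = 0" if "i \<notin> S" "i \<noteq> j" for i j
  proof (cases "i = k")
    case True
    have "A $ k $ j = 0" if "j \<notin> S"
      using insert.prems(2)[of j k] that sym[of k j] \<open>i \<noteq> j\<close> True by auto
    then show ?thesis using True uk dp[of k] unfolding B by (auto simp: u_def sym[of k j])
  next
    case False
    then have "A $ i $ j = 0" "A $ i $ k = 0" using insert.prems(2) that by auto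
    then show ?thesis unfolding B using that by (simp add: u_def)
  qed
  ultimately have "0 < det A \<and> det A \<le> (\<Prod>i\<in>UNIV. B $ i $ i)" and "\<And>i. 0 < B $ i $ i"
    using insert.IH[of B] pos_def_diagonal_pos by auto
  moreover have "(\<Prod>i\<in>UNIV. B $ i $ i) \<le> (\<Prod>i\<in>UNIV. A $ i $ i)"
    using \<open>\<And>i. 0 < B $ i $ i\<close> \<open>\<And>i. B $ i $ i \<le> A $ i $ i\<close> by (intro prod_mono) (auto simp: less_imp_le)
  ultimately show ?case by linarith
qed

text \<open>Hadamard's inequality bounds the determinant by the product of the diagonal; the
  inequality of arithmetic and geometric means turns the product into the trace.\<close>

lemma pos_def_ln_det_le:
  fixes A :: "real ^ 'n ^ 'n"
  assumes "pos_def A"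
  shows "0 < det A" "ln (det A) \<le> CARD('n) * ln (trace A / CARD('n))"
proof -
  have det: "0 < det A \<and> det A \<le> (\<Prod>i\<in>UNIV. A $ i $ i)"
    using assms by (intro pos_def_hadamard_aux[of UNIV]) auto
  note dp = pos_def_diagonal_pos[OF assms]
  have "(\<Prod>i\<in>UNIV. A $ i $ i) powr (1 / CARD('n)) \<le> (\<Sum>i\<in>UNIV. A $ i $ i / CARD('n))"
    using dp by (intro arith_geom_mean) (auto simp: less_imp_le)
  also have "\<dots> = trace A / CARD('n)" by (simp add: trace_def sum_divide_distrib)
  finally have "ln ((\<Prod>i\<in>UNIV. A $ i $ i) powr (1 / CARD('n))) \<le> ln (trace A / CARD('n))"
    using prod_pos[of UNIV "\<lambda>i. A $ i $ i"] dp by (intro ln_mono) (auto simp: less_imp_neq[THEN not_sym])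
  then have "ln (\<Prod>i\<in>UNIV. A $ i $ i) \<le> CARD('n) * ln (trace A / CARD('n))"
    by (simp add: ln_powr field_simps)
  moreover have "ln (det A) \<le> ln (\<Prod>i\<in>UNIV. A $ i $ i)"
    using det by (subst ln_le_cancel_iff) auto
  ultimately show "ln (det A) \<le> CARD('n) * ln (trace A / CARD('n))" by linarith
  show "0 < det A" using det by simp
qed

section \<open>Sums of rank-one matrices and the log-determinant potential\<close>

lemma outer_square_mult_vec: "outer_square v *v x = (v \<bullet> x) *\<^sub>R v"
  by (simp add: outer_square_def matrix_vector_mult_def vec_eq_iff inner_vec_def sum_distrib_left
      mult.assoc mult.commute mult.left_commute)

lemma inner_sum_outer_square_mult_vec:
  "x \<bullet> ((\<Sum>s\<in>S. outer_square (w s)) *v z) = (\<Sum>s\<in>S. (w s \<bullet> x) * (w s \<bullet> z))"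
  by (induction S rule: infinite_finite_induct)
    (auto simp: matrix_vector_mult_add_rdistrib outer_square_mult_vec inner_add_right inner_commute)

lemma pos_def_one_add_sum_outer_square:
  "pos_def (mat 1 + (\<Sum>s\<in>S. outer_square (w s)))"
proof -
  have "transpose (\<Sum>s\<in>S. outer_square (w s)) = (\<Sum>s\<in>S. outer_square (w s))"
    by (simp add: transpose_def outer_square_def vec_eq_iff mult.commute)
  then have "transpose (mat 1 + (\<Sum>s\<in>S. outer_square (w s))) = mat 1 + (\<Sum>s\<in>S. outer_square (w s))"
    by (simp add: transpose_def vec_eq_iff mat_def)
  moreover have "0 < x \<bullet> ((mat 1 + (\<Sum>s\<in>S. outer_square (w s))) *v x)" if "x \<noteq> 0" for x
    using that by (auto simp: matrix_vector_mult_add_rdistrib inner_add_right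
        inner_sum_outer_square_mult_vec intro!: add_pos_nonneg sum_nonneg)
  ultimately show ?thesis by (simp add: pos_def_def)
qed

lemma trace_one_add_sum_outer_square:
  fixes w :: "'a \<Rightarrow> real ^ 'n"
  shows "trace (mat 1 + (\<Sum>s\<in>S. outer_square (w s))) = CARD('n) + (\<Sum>s\<in>S. (norm (w s))\<^sup>2)"
proof -
  have "trace (outer_square v) = (norm v)\<^sup>2" for v :: "real ^ 'n"
    by (simp add: trace_def outer_square_def power2_norm_eq_inner inner_vec_def)
  moreover have "trace (\<Sum>s\<in>S. outer_square (w s)) = (\<Sum>s\<in>S. trace (outer_square (w s)))"
    by (simp add: trace_def sum.swap[of _ S])
  ultimately show ?thesis by (simp add: trace_add trace_I)
qed

text \<open>Here \<open>y t\<close> stands for the inverse of \<open>A t\<close> applied to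
  \<open>w t\<close>, given as the solution of a linear system. Each summand equals 1 minus the
  ratio of consecutive determinants, hence is at most the increment of the log-determinant, and
  these increments telescope.\<close>

lemma elliptical_potential:
  fixes w :: "nat \<Rightarrow> real ^ 'n"
  defines "A \<equiv> \<lambda>t. mat 1 + (\<Sum>s\<in>{1..t}. outer_square (w s))"
  obtains y where "\<And>t. A t *v y t = w t"
    and "(\<Sum>t=1..T. w t \<bullet> y t) \<le> CARD('n) * ln (1 + (\<Sum>t=1..T. (norm (w t))\<^sup>2) / CARD('n))"
proof -
  have pd: "pos_def (A t)" for t unfolding A_def by (rule pos_def_one_add_sum_outer_square)
  note det_pos = pos_def_ln_det_le(1)[OF pd]
  have "\<exists>y. A t *v y = w t" for t
    using det_pos[of t] cramer[of "A t"] by auto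
  then obtain y where y: "\<And>t. A t *v y t = w t" by metis
  have step: "w (Suc t) \<bullet> y (Suc t) \<le> ln (det (A (Suc t))) - ln (det (A t))" for t
  proof -
    \<comment> \<open>Multiplying \<open>A (Suc t)\<close> by this matrix takes the newest outer
      square off again, because \<open>A (Suc t)\<close> maps \<open>y (Suc t)\<close> to
      \<open>w (Suc t)\<close>.\<close>
    let ?E = "(\<chi> i j. (if i = j then 1 else 0) + (- y (Suc t)) $ i * w (Suc t) $ j) :: real^'n^'n"
    have "(A (Suc t) ** ?E) $ i $ j = A (Suc t) $ i $ j - (A (Suc t) *v y (Suc t)) $ i * w (Suc t) $ j" for i j
      by (simp add: matrix_matrix_mult_def matrix_vector_mult_def algebra_simps sum.distrib
          sum_subtractf sum_distrib_left if_distrib[of "\<lambda>z. z * _"] cong: if_cong)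
    then have "A (Suc t) ** ?E = A t"
      unfolding y by (simp add: vec_eq_iff A_def outer_square_def)
    then have "det (A t) = det (A (Suc t)) * (1 - w (Suc t) \<bullet> y (Suc t))"
      using det_mul[of "A (Suc t)" ?E] det_one_add_rank_one[of "- y (Suc t)" "w (Suc t)"]
      by (simp add: inner_commute)
    then have *: "det (A t) / det (A (Suc t)) = 1 - w (Suc t) \<bullet> y (Suc t)"
      using det_pos[of "Suc t"] by (simp add: field_simps)
    have "ln (det (A t) / det (A (Suc t))) \<le> det (A t) / det (A (Suc t)) - 1"
      using det_pos by (intro ln_le_minus_one) simp
    moreover have "ln (det (A t) / det (A (Suc t))) = ln (det (A t)) - ln (det (A (Suc t)))"
      using det_pos[of t] det_pos[of "Suc t"] by (simp add: ln_div)
    ultimately show ?thesis using * by linarith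
  qed
  have "(\<Sum>t=1..T. w t \<bullet> y t) \<le> ln (det (A T))"
  proof (induction T)
    case 0
    then show ?case by (simp add: A_def)
  next
    case (Suc T)
    then show ?case using step[of T] by simp
  qed
  also have "\<dots> \<le> CARD('n) * ln (1 + (\<Sum>t=1..T. (norm (w t))\<^sup>2) / CARD('n))"
    using pos_def_ln_det_le(2)[OF pd[of T]] unfolding A_def trace_one_add_sum_outer_square
    by (simp add: add_divide_distrib)
  finally show ?thesis using that y by blast
qed

section \<open>Exp-concave functions\<close>

text \<open>Along the segment from \<open>x\<close> to \<open>y\<close> all difference quotients at
  \<open>x\<close> are at least \<open>h y - h x\<close>, and they tend to the derivative. Working
  on the segment keeps the argument valid for sets with empty interior.\<close>

lemma concave_on_derivative_bound:
  fixes h :: "'a::real_normed_vector \<Rightarrow> real"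
  assumes "concave_on X h" and "x \<in> X" "y \<in> X"
    and der: "(h has_derivative h') (at x within X)"
  shows "h y - h x \<le> h' (y - x)"
proof -
  have cX: "convex X" using assms(1) by (simp add: concave_on_def convex_on_def)
  interpret h': bounded_linear h' using der by (rule has_derivative_bounded_linear)
  define c where "c = (\<lambda>\<tau>::real. x + \<tau> *\<^sub>R (y - x))"
  have cin: "c ` {0..1} \<subseteq> X"
    using cX assms(2,3) unfolding c_def convex_alt
    by (auto simp: algebra_simps)
  have "(c has_derivative (\<lambda>\<tau>. \<tau> *\<^sub>R (y - x))) (at 0 within {0..1})"
    unfolding c_def by (auto intro!: derivative_eq_intros)
  moreover have "(h has_derivative h') (at (c 0) within c ` {0..1})"
    using der cin unfolding c_def by (auto intro: has_derivative_subset)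
  ultimately have "((h \<circ> c) has_derivative h' \<circ> (\<lambda>\<tau>. \<tau> *\<^sub>R (y - x))) (at 0 within {0..1})"
    by (rule diff_chain_within)
  then have "((h \<circ> c) has_real_derivative h' (y - x)) (at 0 within {0..1})"
    unfolding has_field_derivative_def
    by (rule has_derivative_eq_rhs) (simp add: fun_eq_iff h'.scaleR)
  then have lim: "((\<lambda>\<tau>. (h (c \<tau>) - h x) / \<tau>) \<longlongrightarrow> h' (y - x)) (at 0 within {0..1})"
    by (simp add: has_field_derivative_iff c_def)
  have "\<forall>\<^sub>F \<tau> in at 0 within {0..1}. h y - h x \<le> (h (c \<tau>) - h x) / \<tau>"
  proof -
    have "h y - h x \<le> (h (c \<tau>) - h x) / \<tau>" if "\<tau> \<in> {0..1}" "\<tau> \<noteq> 0" for \<tau>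
    proof -
      have "(1 - \<tau>) * h x + \<tau> * h y \<le> h ((1 - \<tau>) *\<^sub>R x + \<tau> *\<^sub>R y)"
        using concave_onD[OF assms(1), of \<tau> x y] assms that by auto
      moreover have "(1 - \<tau>) *\<^sub>R x + \<tau> *\<^sub>R y = c \<tau>" by (simp add: c_def algebra_simps)
      ultimately show ?thesis using that by (simp add: field_simps)
    qed
    then show ?thesis by (auto simp: eventually_at_filter)
  qed
  moreover have "at (0::real) within {0..1} \<noteq> bot"
    by (simp add: trivial_limit_within islimpt_Icc)
  ultimately show ?thesis using lim by (intro tendsto_lowerbound[where F = "at 0 within {0..1}"])
qed

text \<open>The difference of the two sides has derivative s (1 + s) / (2 (1 - s)), which has the
  sign of s, so it is smallest at 0, where it vanishes.\<close>

lemma neg_ln_one_minus_ge: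
  fixes z :: real
  assumes "\<bar>z\<bar> \<le> 1/4"
  shows "z + z\<^sup>2 / 4 \<le> - ln (1 - z)"
proof -
  define k where "k = (\<lambda>z::real. - ln (1 - z) - z - z\<^sup>2 / 4)"
  have der: "(k has_real_derivative (1 / (1 - s) - 1 - s / 2)) (at s)" if "\<bar>s\<bar> \<le> 1/4" for s
    unfolding k_def using that by (auto intro!: derivative_eq_intros simp: field_simps)
  have sgn: "1 / (1 - s) - 1 - s / 2 = s * (1 + s) / (2 * (1 - s))" if "\<bar>s\<bar> \<le> 1/4" for s :: real
    using that by (simp add: field_simps power2_eq_square)
  have "k 0 \<le> k z"
  proof (cases "z \<ge> 0")
    case True
    have "\<exists>y. (k has_real_derivative y) (at s) \<and> y \<ge> 0" if "0 \<le> s" "s \<le> z" for s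
      using that assms der[of s] sgn[of s] by (intro exI[of _ "1 / (1 - s) - 1 - s / 2"]) simp
    with True show ?thesis by (rule DERIV_nonneg_imp_nondecreasing)
  next
    case False
    have "\<exists>y. (k has_real_derivative y) (at s) \<and> y \<le> 0" if "z \<le> s" "s \<le> 0" for s
      using that assms der[of s] sgn[of s]
      by (intro exI[of _ "1 / (1 - s) - 1 - s / 2"]) (simp add: divide_nonpos_pos mult_nonpos_nonneg)
    with False show ?thesis by (intro DERIV_nonpos_imp_nonincreasing[of z 0 k]) auto
  qed
  then show ?thesis by (simp add: k_def)
qed

text \<open>By concavity of the logarithm, as \<open>1 - b * s\<close> is the convex combination of
  1 and \<open>1 - a * s\<close> with weight \<open>b / a\<close>. It replaces the exponent \<alpha>
  by the smaller 2 \<beta>.\<close>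

lemma ln_one_minus_scale:
  fixes a b s :: real
  assumes "0 < b" "b \<le> a" "a * s < 1"
  shows "- ln (1 - b * s) / b \<le> - ln (1 - a * s) / a"
proof -
  have "(1 - b / a) * ln 1 + (b / a) * ln (1 - a * s) \<le> ln ((1 - b / a) *\<^sub>R 1 + (b / a) *\<^sub>R (1 - a * s))"
    using assms concave_onD[OF ln_concave, of "b / a" 1 "1 - a * s"] by simp
  moreover have "(1 - b / a) *\<^sub>R 1 + (b / a) *\<^sub>R (1 - a * s) = 1 - b * s"
    using assms by (simp add: field_simps)
  ultimately have "b / a * ln (1 - a * s) \<le> ln (1 - b * s)" by (metis add_0 ln_one mult_zero_right)
  then show ?thesis using assms by (simp add: field_simps)
qed

lemma beta_of_bounds:
  assumes "G > 0" "D > 0" "\<alpha> > 0"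
  shows "0 < beta_of D G \<alpha>" "2 * beta_of D G \<alpha> \<le> \<alpha>" "2 * beta_of D G \<alpha> * (G * D) \<le> 1 / 4"
proof -
  show "0 < beta_of D G \<alpha>" "2 * beta_of D G \<alpha> \<le> \<alpha>" using assms by (auto simp: beta_of_def min_def)
  have "2 * beta_of D G \<alpha> \<le> 1 / (4 * G * D)" by (simp add: beta_of_def)
  then show "2 * beta_of D G \<alpha> * (G * D) \<le> 1 / 4" using assms by (simp add: field_simps)
qed

text \<open>Take logarithms in the first-order inequality for the concave function
  \<open>exp (- \<alpha> * h)\<close>, lower \<alpha> to 2 \<beta>, and expand the logarithm to
  second order. The bound 1/(4GD) in \<open>beta_of\<close> keeps the argument of the expansion
  within 1/4.\<close>

lemma exp_concave_on_quadratic_bound: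
  fixes h :: "real ^ 'd \<Rightarrow> real"
  assumes "exp_concave_on \<alpha> X h" "gradient_on X grad h" "x \<in> X" "y \<in> X"
    and "G > 0" "D > 0" "\<alpha> > 0"
    and "norm (grad h x) \<le> G" "norm (x - y) \<le> D"
    and \<beta>: "\<beta> = beta_of D G \<alpha>"
  shows "h x - h y \<le> grad h x \<bullet> (x - y) - \<beta> / 2 * (grad h x \<bullet> (x - y))\<^sup>2"
proof -
  define s where "s = grad h x \<bullet> (y - x)"
  note b = beta_of_bounds[OF \<open>G > 0\<close> \<open>D > 0\<close> \<open>\<alpha> > 0\<close>, folded \<beta>]
  have "(h has_derivative (\<lambda>v. grad h x \<bullet> v)) (at x within X)"
    using assms by (auto simp: gradient_on_def)
  then have "((\<lambda>z. exp (- \<alpha> * h z)) has_derivative (\<lambda>v. exp (- \<alpha> * h x) * (- \<alpha> * (grad h x \<bullet> v)))) (at x within X)"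
    by (auto intro!: derivative_eq_intros)
  then have "exp (- \<alpha> * h y) - exp (- \<alpha> * h x) \<le> exp (- \<alpha> * h x) * (- \<alpha> * s)"
    unfolding s_def using assms(1,3,4) by (intro concave_on_derivative_bound) (auto simp: exp_concave_on_def)
  then have "exp (- \<alpha> * h y) \<le> exp (- \<alpha> * h x) * (1 - \<alpha> * s)" by (simp add: algebra_simps)
  moreover have "exp (- \<alpha> * h y) = exp (- \<alpha> * h x) * exp (\<alpha> * (h x - h y))"
    by (simp add: exp_add[symmetric] algebra_simps)
  ultimately have e: "exp (\<alpha> * (h x - h y)) \<le> 1 - \<alpha> * s" by simp
  then have pos: "0 < 1 - \<alpha> * s" by (rule less_le_trans[OF exp_gt_zero])
  have "\<alpha> * (h x - h y) \<le> ln (1 - \<alpha> * s)"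
    using e pos by (simp add: ln_ge_iff)
  then have "- ln (1 - \<alpha> * s) / \<alpha> \<le> h y - h x" using \<open>\<alpha> > 0\<close> by (simp add: field_simps)
  moreover have "- ln (1 - 2 * \<beta> * s) / (2 * \<beta>) \<le> - ln (1 - \<alpha> * s) / \<alpha>"
    using b pos by (intro ln_one_minus_scale) auto
  moreover have "s + \<beta> / 2 * s\<^sup>2 \<le> - ln (1 - 2 * \<beta> * s) / (2 * \<beta>)"
  proof -
    have "\<bar>s\<bar> \<le> norm (grad h x) * norm (y - x)" unfolding s_def by (rule Cauchy_Schwarz_ineq2)
    also have "\<dots> \<le> G * D" using assms by (intro mult_mono) (auto simp: norm_minus_commute)
    finally have "2 * \<beta> * \<bar>s\<bar> \<le> 2 * \<beta> * (G * D)" using b by (intro mult_left_mono) auto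
    then have "\<bar>2 * \<beta> * s\<bar> \<le> 1 / 4" using b(1,3) by (simp only: abs_mult)
    from neg_ln_one_minus_ge[OF this] show ?thesis
      using b by (simp add: field_simps power2_eq_square)
  qed
  moreover have "grad h x \<bullet> (x - y) = - s" by (simp add: s_def inner_diff_right)
  ultimately show ?thesis by simp
qed

section \<open>Regret of a single realisation\<close>

lemma mat_norm_sq_add:
  assumes "\<And>a b. a \<bullet> (H *v b) = b \<bullet> (H *v a)"
  shows "mat_norm_sq H (a + b) = mat_norm_sq H a + 2 * (a \<bullet> (H *v b)) + mat_norm_sq H b"
  using assms[of b a]
  by (simp add: mat_norm_sq_def matrix_vector_right_distrib inner_add_left inner_add_right)

lemma mat_norm_sq_scaleR: "mat_norm_sq H (c *\<^sub>R a) = c\<^sup>2 * mat_norm_sq H a"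
  by (simp add: mat_norm_sq_def matrix_vector_mult_scaleR power2_eq_square)

lemma mat_norm_sq_minus_commute: "mat_norm_sq H (a - b) = mat_norm_sq H (b - a)"
  using mat_norm_sq_scaleR[of H "-1" "a - b"] by simp

text \<open>First-order optimality of \<open>z\<close> in the direction of \<open>u\<close>,
  rewritten by expanding the quadratic form at \<open>u - c = (u - z) + (z - c)\<close>.\<close>

lemma arg_min_three_point:
  assumes sym: "\<And>a b. a \<bullet> (H *v b) = b \<bullet> (H *v a)"
    and "convex X" "u \<in> X"
    and min: "is_arg_min (oomd_objective g H c) (\<lambda>z. z \<in> X) z"
  shows "g \<bullet> (z - u) \<le> 1 / 2 * (mat_norm_sq H (u - c) - mat_norm_sq H (u - z) - mat_norm_sq H (z - c))"
proof -
  have zX: "z \<in> X" and le: "\<And>y. y \<in> X \<Longrightarrow> oomd_objective g H c z \<le> oomd_objective g H c y"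
    using min by (auto simp: is_arg_min_linorder)
  define p where "p = u - z"
  \<comment> \<open>The directional derivative of the objective at \<open>z\<close> towards
    \<open>u\<close>. A step of length \<open>\<tau>\<close>, divided by \<open>\<tau>\<close>,
    shows that it is nonnegative in the limit.\<close>
  define q where "q = g \<bullet> p + p \<bullet> (H *v (z - c))"
  have ge: "0 \<le> q + \<tau> / 2 * mat_norm_sq H p" if "0 < \<tau>" "\<tau> \<le> 1" for \<tau>
  proof -
    have eq: "z + \<tau> *\<^sub>R p = (1 - \<tau>) *\<^sub>R z + \<tau> *\<^sub>R u" by (simp add: p_def algebra_simps)
    have "z + \<tau> *\<^sub>R p \<in> X"
      unfolding eq using assms(2,3) zX that by (simp add: convex_alt)
    then have "oomd_objective g H c z \<le> oomd_objective g H c (z + \<tau> *\<^sub>R p)" by (rule le)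
    also have "\<dots> = oomd_objective g H c z + \<tau> * (q + \<tau> / 2 * mat_norm_sq H p)"
    proof -
      have "z + \<tau> *\<^sub>R p - c = \<tau> *\<^sub>R p + (z - c)" by simp
      then have "mat_norm_sq H (z + \<tau> *\<^sub>R p - c)
          = \<tau>\<^sup>2 * mat_norm_sq H p + 2 * \<tau> * (p \<bullet> (H *v (z - c))) + mat_norm_sq H (z - c)"
        by (simp only: mat_norm_sq_add[OF sym] mat_norm_sq_scaleR) simp
      then show ?thesis
        unfolding oomd_objective_def q_def
        by (simp add: mat_norm_sq_scaleR inner_add_right power2_eq_square algebra_simps)
    qed
    finally show ?thesis using that by (simp add: zero_le_mult_iff)
  qed
  have "((\<lambda>\<tau>. q + \<tau> / 2 * mat_norm_sq H p) \<longlongrightarrow> q + 0 / 2 * mat_norm_sq H p) (at_right 0)"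
    by (intro tendsto_intros) auto
  moreover have "\<forall>\<^sub>F \<tau> in at_right 0. 0 \<le> q + \<tau> / 2 * mat_norm_sq H p"
    using ge by (auto simp: eventually_at_right_field intro: exI[of _ 1])
  ultimately have "0 \<le> q" by (intro tendsto_lowerbound[where F = "at_right 0"]) auto
  moreover have "mat_norm_sq H (u - c) = mat_norm_sq H p + 2 * (p \<bullet> (H *v (z - c))) + mat_norm_sq H (z - c)"
    using mat_norm_sq_add[OF sym, where a=p and b="z - c"] by (simp add: p_def)
  moreover have "g \<bullet> (z - u) = - (g \<bullet> p)" by (simp add: p_def inner_diff_right)
  ultimately show ?thesis by (simp add: q_def p_def)
qed

section \<open>The matrices of the algorithm as quadratic forms\<close>

lemma inner_oomd_matrix_mult_vec:
  "a \<bullet> (oomd_matrix \<beta> G g t *v b)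
    = (1 + \<beta> / 2 * G\<^sup>2) * (a \<bullet> b) + \<beta> / 2 * (\<Sum>s\<in>{1..<t}. (g s \<bullet> a) * (g s \<bullet> b))"
  by (simp add: oomd_matrix_def matrix_vector_mult_add_rdistrib scaleR_matrix_vector_assoc[symmetric]
      inner_add_right inner_sum_outer_square_mult_vec algebra_simps)

lemma oomd_matrix_symmetric:
  "a \<bullet> (oomd_matrix \<beta> G g t *v b) = b \<bullet> (oomd_matrix \<beta> G g t *v a)"
  unfolding inner_oomd_matrix_mult_vec by (simp add: inner_commute mult.commute)

lemma mat_norm_sq_oomd_matrix:
  "mat_norm_sq (oomd_matrix \<beta> G g t) v
    = (1 + \<beta> / 2 * G\<^sup>2) * (norm v)\<^sup>2 + \<beta> / 2 * (\<Sum>s\<in>{1..<t}. (g s \<bullet> v)\<^sup>2)"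
  unfolding mat_norm_sq_def inner_oomd_matrix_mult_vec by (simp add: power2_norm_eq_inner[symmetric] power2_eq_square[symmetric])

lemma mat_norm_sq_oomd_matrix_Suc:
  assumes "t \<ge> 1"
  shows "mat_norm_sq (oomd_matrix \<beta> G g (t + 1)) v
    = mat_norm_sq (oomd_matrix \<beta> G g t) v + \<beta> / 2 * (g t \<bullet> v)\<^sup>2"
  using assms unfolding mat_norm_sq_oomd_matrix by (simp add: algebra_simps)

lemma mat_norm_sq_oomd_matrix_ge:
  assumes "\<beta> \<ge> 0"
  shows "(1 + \<beta> / 2 * G\<^sup>2) * (norm v)\<^sup>2 \<le> mat_norm_sq (oomd_matrix \<beta> G g t) v"
  using assms unfolding mat_norm_sq_oomd_matrix by (simp add: sum_nonneg)

lemma power2_add_le: "(a + b)\<^sup>2 \<le> 2 * a\<^sup>2 + 2 * (b::real)\<^sup>2"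
  using sum_squares_bound[of a b] by (simp add: power2_sum)

lemma norm_add_power2_le: "(norm (a + b))\<^sup>2 \<le> 2 * (norm a)\<^sup>2 + 2 * (norm (b::'a::real_normed_vector))\<^sup>2"
proof -
  have "(norm (a + b))\<^sup>2 \<le> (norm a + norm b)\<^sup>2" by (intro power_mono norm_triangle_ineq) simp
  then show ?thesis using power2_add_le[of "norm a" "norm b"] by linarith
qed

text \<open>The optimistic gradient \<open>m t\<close> is the previous gradient. The vectors \<open>v t = g t - m t\<close>
  satisfy $\frac18\sum_{s\le t} v_s v_s^\top \preceq \frac12\sum_{s\le t} g_s g_s^\top$.\<close>

lemma sum_inner_diff_power2_le:
  fixes g :: "nat \<Rightarrow> 'a::real_inner"
  defines "v \<equiv> \<lambda>t. g t - (if t = 1 then 0 else g (t - 1))"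
  shows "(\<Sum>s=1..t. (v s \<bullet> z)\<^sup>2) \<le> 4 * (\<Sum>s=1..t. (g s \<bullet> z)\<^sup>2)"
proof -
  have "(\<Sum>s=1..t. (v s \<bullet> z)\<^sup>2) + 2 * (if t = 0 then 0 else (g t \<bullet> z)\<^sup>2) \<le> 4 * (\<Sum>s=1..t. (g s \<bullet> z)\<^sup>2)"
  proof (induction t)
    case (Suc t)
    have "(v (Suc t) \<bullet> z)\<^sup>2 \<le> 2 * (g (Suc t) \<bullet> z)\<^sup>2 + 2 * (if t = 0 then 0 else (g t \<bullet> z)\<^sup>2)"
      using power2_add_le[of "g (Suc t) \<bullet> z" "- (g t \<bullet> z)"] by (simp add: v_def inner_diff_left)
    then show ?case using Suc by simp
  qed simp
  then show ?thesis by (smt (verit) zero_le_power2)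
qed

lemma oomd_run_mem:
  assumes "oomd_run T X grad \<beta> G x1 l x xh" "x1 \<in> X" "t \<in> {1..T + 1}"
  shows "x t \<in> X" "xh t \<in> X"
proof -
  have "x t \<in> X \<and> xh t \<in> X"
  proof (cases "t = 1")
    case False
    then have "t - 1 \<in> {1..T}" "t - 1 + 1 = t" using assms(3) by auto
    then show ?thesis using assms(1) unfolding oomd_run_def Let_def is_arg_min_def by metis
  qed (use assms in \<open>auto simp: oomd_run_def Let_def\<close>)
  then show "x t \<in> X" "xh t \<in> X" by auto
qed

text \<open>A pathwise statement: the regret of optimistic mirror descent with the previous gradient
  as prediction. The quadratic gain in \<open>loss\<close> compensates for the growth from
  \<open>H t\<close> to \<open>H (t + 1)\<close>, and the movement of the iterates is kept as a
  negative term for later use.\<close>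

lemma oomd_regret:
  fixes x xh :: "nat \<Rightarrow> real ^ 'd" and grad :: "(real ^ 'd \<Rightarrow> real) \<Rightarrow> real ^ 'd \<Rightarrow> real ^ 'd"
    and l :: "nat \<Rightarrow> real ^ 'd \<Rightarrow> real"
    and n :: real
  defines "h \<equiv> \<lambda>t. grad (l t) (x t)" and "n \<equiv> CARD('d)"
  assumes run: "oomd_run T X grad \<beta> G x1 l x xh"
    and X: "convex X" "u \<in> X" "x1 \<in> X" "norm (u - x1) \<le> D"
    and \<beta>: "\<beta> > 0" and G: "G \<ge> 0"
    and bound: "\<And>t. t \<in> {1..T} \<Longrightarrow> norm (h t) \<le> G"
    and loss: "\<And>t. t \<in> {1..T} \<Longrightarrow>
      l t (x t) - l t u \<le> h t \<bullet> (x t - u) - \<beta> / 2 * (h t \<bullet> (x t - u))\<^sup>2"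
  shows "(\<Sum>t=1..T. l t (x t) - l t u)
    \<le> 16 * n / \<beta> * ln (1 + \<beta> / (8 * n) *
          (\<Sum>t=1..T. (norm (h t - (if t = 1 then 0 else h (t - 1))))\<^sup>2))
      + D\<^sup>2 * (1 + \<beta> / 2 * G\<^sup>2)
      - 1 / 4 * (\<Sum>t=2..T. (norm (x t - x (t - 1)))\<^sup>2)"
proof -
  define m where "m t = (if t = 1 then 0 else h (t - 1))" for t
  define v where "v t = h t - m t" for t
  define H where "H t = oomd_matrix \<beta> G h t" for t
  have init: "x 1 = x1" "xh 1 = x1"
    and min1: "\<And>t. t \<in> {1..T} \<Longrightarrow> is_arg_min (oomd_objective (h t) (H t) (xh t)) (\<lambda>z. z \<in> X) (xh (t + 1))"
    and min2: "\<And>t. t \<in> {1..T} \<Longrightarrow> is_arg_min (oomd_objective (h t) (H (t + 1)) (xh (t + 1))) (\<lambda>z. z \<in> X) (x (t + 1))"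
    using run unfolding oomd_run_def Let_def H_def h_def by auto
  note sym = oomd_matrix_symmetric[of _ \<beta> G h, folded H_def]
  have Hge: "(1 + \<beta> / 2 * G\<^sup>2) * (norm z)\<^sup>2 \<le> mat_norm_sq (H t) z" for t z
    using mat_norm_sq_oomd_matrix_ge[of \<beta> G] \<beta> by (simp add: H_def)
  then have Hge1: "(norm z)\<^sup>2 \<le> mat_norm_sq (H t) z" for t z
    using \<beta> by (smt (verit) mult_le_cancel_right1 mult_nonneg_nonneg zero_le_power2 half_gt_zero)
  note xin = oomd_run_mem[OF run X(3)]
  have opt_m: "m t \<bullet> (x t - z) \<le> 1 / 2 * (mat_norm_sq (H t) (z - xh t) - mat_norm_sq (H t) (z - x t) - mat_norm_sq (H t) (x t - xh t))"
    if "t \<in> {1..T}" "z \<in> X" for t z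
  proof (cases "t = 1")
    case True
    \<comment> \<open>No minimisation stands behind the first decision, but \<open>m 1 = 0\<close>
      and \<open>x 1 = xh 1\<close> make both sides vanish.\<close>
    then show ?thesis using init by (simp add: m_def mat_norm_sq_def)
  next
    case False
    then have "t - 1 \<in> {1..T}" "t - 1 + 1 = t" using that by auto
    then have "is_arg_min (oomd_objective (h (t - 1)) (H t) (xh t)) (\<lambda>z. z \<in> X) (x t)"
      using min2[of "t - 1"] by simp
    from arg_min_three_point[OF sym X(1) that(2) this] show ?thesis using False by (simp add: m_def)
  qed
  have opt_g: "h t \<bullet> (xh (t + 1) - z) \<le> 1 / 2 * (mat_norm_sq (H t) (z - xh t) - mat_norm_sq (H t) (z - xh (t + 1)) - mat_norm_sq (H t) (xh (t + 1) - xh t))"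
    if "t \<in> {1..T}" "z \<in> X" for t z
    using arg_min_three_point[OF sym X(1) that(2) min1[OF that(1)]] .
  \<comment> \<open>The scaling for which the identity plus the outer squares of \<open>w\<close> is
    the matrix \<open>A_t\<close> of the overview.\<close>
  define w where "w t = sqrt (\<beta> / 8) *\<^sub>R v t" for t
  obtain y where y: "\<And>t. (mat 1 + (\<Sum>s\<in>{1..t}. outer_square (w s))) *v y t = w t"
    and pot: "(\<Sum>t=1..T. w t \<bullet> y t) \<le> CARD('d) * ln (1 + (\<Sum>t=1..T. (norm (w t))\<^sup>2) / CARD('d))"
    by (rule elliptical_potential[of w T]) (rule that)
  define \<delta> where "\<delta> t = x t - xh (t + 1)" for t
  \<comment> \<open>Each of the two minimisers is tested against the other; on adding, the distances
    to \<open>xh t\<close> cancel.\<close>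
  have stab: "mat_norm_sq (H t) (\<delta> t) \<le> v t \<bullet> \<delta> t" if "t \<in> {1..T}" for t
    using opt_m[OF that, of "xh (t + 1)"] opt_g[OF that, of "x t"] xin[of t] xin[of "t + 1"] that
    by (auto simp: \<delta>_def v_def inner_diff_left inner_diff_right mat_norm_sq_minus_commute)
  have dom: "(norm z)\<^sup>2 + (\<Sum>s=1..t. (w s \<bullet> z)\<^sup>2) \<le> mat_norm_sq (H t) z" if "t \<in> {1..T}" for t z
  proof -
    have "(\<Sum>s=1..t. (w s \<bullet> z)\<^sup>2) = \<beta> / 8 * (\<Sum>s=1..t. (v s \<bullet> z)\<^sup>2)"
      using \<beta> by (simp add: w_def power_mult_distrib sum_distrib_left)
    also have "\<dots> \<le> \<beta> / 8 * (4 * (\<Sum>s=1..t. (h s \<bullet> z)\<^sup>2))"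
      using \<beta> sum_inner_diff_power2_le[of h z t] unfolding v_def m_def
      by (intro mult_left_mono) auto
    \<comment> \<open>\<open>H t\<close> sums only over rounds before \<open>t\<close>; the summand
      of round \<open>t\<close> is absorbed by the multiple \<open>\<beta> / 2 * G\<^sup>2\<close>
      of the identity.\<close>
    also have "(\<Sum>s=1..t. (h s \<bullet> z)\<^sup>2) = (\<Sum>s\<in>{1..<t}. (h s \<bullet> z)\<^sup>2) + (h t \<bullet> z)\<^sup>2"
      using that by (cases t) (auto simp: atLeastLessThanSuc_atLeastAtMost)
    also have "(h t \<bullet> z)\<^sup>2 \<le> G\<^sup>2 * (norm z)\<^sup>2"
    proof -
      have "\<bar>h t \<bullet> z\<bar> \<le> norm (h t) * norm z" by (rule Cauchy_Schwarz_ineq2)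
      also have "\<dots> \<le> G * norm z" using bound[OF that] by (intro mult_right_mono) auto
      finally have "\<bar>h t \<bullet> z\<bar>\<^sup>2 \<le> (G * norm z)\<^sup>2" by (intro power_mono) auto
      then show ?thesis by (simp add: power_mult_distrib)
    qed
    finally show ?thesis using \<beta> unfolding H_def mat_norm_sq_oomd_matrix by (simp add: algebra_simps)
  qed
  have dual: "v t \<bullet> \<delta> t \<le> 8 / \<beta> * (w t \<bullet> y t)" if "t \<in> {1..T}" for t
  proof -
    define k where "k = sqrt (8 / \<beta>)"
    have k: "k\<^sup>2 = 8 / \<beta>" "k > 0" using \<beta> by (auto simp: k_def)
    have vk: "v t = k *\<^sub>R w t"
    proof -
      have "k * sqrt (\<beta> / 8) = 1" unfolding k_def using \<beta> by (simp add: real_sqrt_mult[symmetric])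
      then show ?thesis by (simp add: w_def)
    qed
    let ?A = "mat 1 + (\<Sum>s\<in>{1..t}. outer_square (w s))"
    have A: "a \<bullet> (?A *v b) = a \<bullet> b + (\<Sum>s\<in>{1..t}. (w s \<bullet> a) * (w s \<bullet> b))" for a b
      by (simp add: matrix_vector_mult_add_rdistrib inner_add_right inner_sum_outer_square_mult_vec)
    have Asym: "a \<bullet> (?A *v b) = b \<bullet> (?A *v a)" for a b
      unfolding A by (simp add: inner_commute mult.commute)
    have sq: "mat_norm_sq ?A a = (norm a)\<^sup>2 + (\<Sum>s=1..t. (w s \<bullet> a)\<^sup>2)" for a
      unfolding mat_norm_sq_def A by (simp add: power2_norm_eq_inner[symmetric] power2_eq_square[symmetric])
    \<comment> \<open>Young's inequality in the norm of \<open>?A\<close> by completing the square: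
      \<open>k *\<^sub>R y t\<close> is the inverse of \<open>?A\<close> applied to
      \<open>v t\<close>. With \<open>dom\<close> and \<open>stab\<close>, one copy of the inner
      product of \<open>v t\<close> and \<open>\<delta> t\<close> cancels.\<close>
    have "0 \<le> mat_norm_sq ?A (\<delta> t + (- k) *\<^sub>R y t)" unfolding sq by (simp add: sum_nonneg)
    also have "\<dots> = mat_norm_sq ?A (\<delta> t) - 2 * (v t \<bullet> \<delta> t) + 8 / \<beta> * (w t \<bullet> y t)"
    proof -
      have "mat_norm_sq ?A (y t) = w t \<bullet> y t" by (simp only: mat_norm_sq_def y inner_commute)
      then show ?thesis
        unfolding mat_norm_sq_add[OF Asym] mat_norm_sq_scaleR matrix_vector_mult_scaleR y k(1)[symmetric]
        by (simp add: vk inner_commute)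
    qed
    finally show ?thesis using dom[OF that, of "\<delta> t"] stab[OF that] unfolding sq by linarith
  qed
  define a where "a t = 1 / 2 * mat_norm_sq (H t) (u - xh t)" for t
  define r where "r t = 1 / 2 * (norm (\<delta> t))\<^sup>2 + 1 / 2 * (norm (x t - xh t))\<^sup>2" for t
  have step: "l t (x t) - l t u \<le> 16 / \<beta> * (w t \<bullet> y t) + a t - a (t + 1) - r t" if t: "t \<in> {1..T}" for t
  proof -
    have xi: "xh (t + 1) \<in> X" using xin[of "t + 1"] t by auto
    have "h t \<bullet> (x t - u) = h t \<bullet> (xh (t + 1) - u) + v t \<bullet> \<delta> t + m t \<bullet> (x t - xh (t + 1))"
      by (simp add: v_def \<delta>_def inner_diff_left inner_diff_right)
    moreover have "a (t + 1) = 1 / 2 * mat_norm_sq (H t) (u - xh (t + 1)) + \<beta> / 4 * (h t \<bullet> (u - xh (t + 1)))\<^sup>2"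
      using t mat_norm_sq_oomd_matrix_Suc[of t \<beta> G h] unfolding a_def H_def by simp
    \<comment> \<open>The growth of the matrix is measured at \<open>xh (t + 1)\<close>, the
      quadratic gain at \<open>x t\<close>. Passing from one to the other costs a term in
      \<open>\<delta> t\<close>, bounded below by a second copy of
      \<open>v t \<bullet> \<delta> t\<close>; hence 16 instead of 8.\<close>
    moreover have "h t \<bullet> (u - xh (t + 1)) = - (h t \<bullet> (x t - u)) + h t \<bullet> \<delta> t"
      by (simp add: \<delta>_def inner_diff_right)
    then have "(h t \<bullet> (u - xh (t + 1)))\<^sup>2 \<le> 2 * (h t \<bullet> (x t - u))\<^sup>2 + 2 * (h t \<bullet> \<delta> t)\<^sup>2"
      using power2_add_le[of "- (h t \<bullet> (x t - u))" "h t \<bullet> \<delta> t"] by simp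
    then have "\<beta> / 4 * (h t \<bullet> (u - xh (t + 1)))\<^sup>2 \<le> \<beta> / 4 * (2 * (h t \<bullet> (x t - u))\<^sup>2 + 2 * (h t \<bullet> \<delta> t)\<^sup>2)"
      using \<beta> by (intro mult_left_mono) auto
    moreover have "\<beta> / 2 * (h t \<bullet> \<delta> t)\<^sup>2 \<le> v t \<bullet> \<delta> t"
    proof -
      have "\<bar>h t \<bullet> \<delta> t\<bar> \<le> norm (h t) * norm (\<delta> t)" by (rule Cauchy_Schwarz_ineq2)
      also have "\<dots> \<le> G * norm (\<delta> t)" using bound[OF t] by (intro mult_right_mono) auto
      finally have "\<bar>h t \<bullet> \<delta> t\<bar>\<^sup>2 \<le> (G * norm (\<delta> t))\<^sup>2" by (intro power_mono) auto
      then have "\<beta> / 2 * (h t \<bullet> \<delta> t)\<^sup>2 \<le> \<beta> / 2 * (G\<^sup>2 * (norm (\<delta> t))\<^sup>2)"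
        using \<beta> by (intro mult_left_mono) (auto simp: power_mult_distrib)
      moreover have "(norm (\<delta> t))\<^sup>2 + \<beta> / 2 * (G\<^sup>2 * (norm (\<delta> t))\<^sup>2) \<le> mat_norm_sq (H t) (\<delta> t)"
        using Hge[of "\<delta> t" t] by (simp add: algebra_simps)
      ultimately show ?thesis using stab[OF t] zero_le_power2[of "norm (\<delta> t)"] by linarith
    qed
    moreover have "mat_norm_sq (H t) (xh (t + 1) - x t) = mat_norm_sq (H t) (\<delta> t)"
      unfolding \<delta>_def by (rule mat_norm_sq_minus_commute)
    ultimately show ?thesis
      using loss[OF t] opt_m[OF t xi] opt_g[OF t X(2)] dual[OF t]
        Hge1[of "\<delta> t" t] Hge1[of "x t - xh t" t]
      unfolding a_def[of t] r_def by (simp add: distrib_left)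
  qed
  have "(\<Sum>t=1..T. l t (x t) - l t u) \<le> (\<Sum>t=1..T. 16 / \<beta> * (w t \<bullet> y t) + (a t - a (t + 1)) - r t)"
    using step by (intro sum_mono) (simp add: algebra_simps)
  also have "\<dots> = 16 / \<beta> * (\<Sum>t=1..T. w t \<bullet> y t) + (\<Sum>t=1..T. a t - a (t + 1)) - (\<Sum>t=1..T. r t)"
    by (simp add: sum.distrib sum_subtractf sum_distrib_left)
  finally have total: "(\<Sum>t=1..T. l t (x t) - l t u)
      \<le> 16 / \<beta> * (\<Sum>t=1..T. w t \<bullet> y t) + (\<Sum>t=1..T. a t - a (t + 1)) - (\<Sum>t=1..T. r t)" .
  have tele: "(\<Sum>t=1..T. a t - a (t + 1)) = a 1 - a (T + 1)"
    by (induction T) auto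
  have a_last: "a (T + 1) \<ge> 0"
    unfolding a_def using Hge1[of "u - xh (T + 1)" "T + 1"] zero_le_power2[of "norm (u - xh (T + 1))"] by linarith
  have a_first: "a 1 \<le> D\<^sup>2 * (1 + \<beta> / 2 * G\<^sup>2)"
  proof -
    have "a 1 = 1 / 2 * ((1 + \<beta> / 2 * G\<^sup>2) * (norm (u - x1))\<^sup>2)"
      unfolding a_def H_def mat_norm_sq_oomd_matrix init by simp
    also have "\<dots> \<le> 1 * ((1 + \<beta> / 2 * G\<^sup>2) * D\<^sup>2)"
      using X(4) \<beta> by (intro mult_mono power_mono) auto
    finally show ?thesis by (simp add: mult.commute)
  qed
  have r_sum: "1 / 4 * (\<Sum>t=2..T. (norm (x t - x (t - 1)))\<^sup>2) \<le> (\<Sum>t=1..T. r t)"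
  proof -
    \<comment> \<open>The move from \<open>x (t - 1)\<close> to \<open>x t\<close> passes through
      \<open>xh t\<close> and so takes one half of \<open>r\<close> from each of two consecutive
      rounds; the induction carries the half of the last round that is still unspent.\<close>
    have "1 / 4 * (\<Sum>t=2..T. (norm (x t - x (t - 1)))\<^sup>2) + (if T = 0 then 0 else 1 / 2 * (norm (\<delta> T))\<^sup>2) \<le> (\<Sum>t=1..T. r t)"
    proof (induction T)
      case (Suc T)
      show ?case
      proof (cases "T = 0")
        case False
        have "(norm (x (Suc T) - x T))\<^sup>2 \<le> 2 * (norm (x (Suc T) - xh (Suc T)))\<^sup>2 + 2 * (norm (\<delta> T))\<^sup>2"
          using norm_add_power2_le[of "x (Suc T) - xh (Suc T)" "- \<delta> T"]
          by (simp add: norm_minus_commute \<delta>_def)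
        then show ?thesis using Suc False by (simp add: r_def)
      qed (simp add: r_def)
    qed simp
    moreover have "0 \<le> (if T = 0 then 0 else 1 / 2 * (norm (\<delta> T))\<^sup>2)" by simp
    ultimately show ?thesis by linarith
  qed
  have "(\<Sum>t=1..T. w t \<bullet> y t) \<le> n * ln (1 + \<beta> / (8 * n) * (\<Sum>t=1..T. (norm (v t))\<^sup>2))"
  proof -
    have "(\<Sum>t=1..T. (norm (w t))\<^sup>2) / n = \<beta> / (8 * n) * (\<Sum>t=1..T. (norm (v t))\<^sup>2)"
      using \<beta> by (simp add: w_def power_mult_distrib sum_distrib_left sum_divide_distrib)
    then show ?thesis using pot by (simp add: n_def)
  qed
  then have "16 / \<beta> * (\<Sum>t=1..T. w t \<bullet> y t)
      \<le> 16 / \<beta> * (n * ln (1 + \<beta> / (8 * n) * (\<Sum>t=1..T. (norm (v t))\<^sup>2)))"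
    using \<beta> by (intro mult_left_mono) auto
  then have "(\<Sum>t=1..T. l t (x t) - l t u)
      \<le> 16 * n / \<beta> * ln (1 + \<beta> / (8 * n) * (\<Sum>t=1..T. (norm (v t))\<^sup>2)) + D\<^sup>2 * (1 + \<beta> / 2 * G\<^sup>2)
        - 1 / 4 * (\<Sum>t=2..T. (norm (x t - x (t - 1)))\<^sup>2)"
    using total tele a_last a_first r_sum by simp
  then show ?thesis by (simp add: n_def v_def m_def)
qed


text \<open>Still pathwise: \<open>F\<close> will be the mean gradients and \<open>V\<close> the
  gradient variation. The variation bound starts in round 2, because the first \<open>v\<close> is
  simply a gradient and contributes the term with \<open>G\<^sup>2\<close>.\<close>

lemma oomd_regret_variation:
  fixes x xh :: "nat \<Rightarrow> real ^ 'd" and grad :: "(real ^ 'd \<Rightarrow> real) \<Rightarrow> real ^ 'd \<Rightarrow> real ^ 'd"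
    and l :: "nat \<Rightarrow> real ^ 'd \<Rightarrow> real" and F :: "nat \<Rightarrow> real ^ 'd \<Rightarrow> real ^ 'd"
    and V :: "nat \<Rightarrow> real" and n :: real
  defines "h \<equiv> \<lambda>t. grad (l t) (x t)" and "n \<equiv> CARD('d)"
  assumes run: "oomd_run T X grad \<beta> G x1 l x xh" and "T \<ge> 1"
    and X: "convex X" "u \<in> X" "x1 \<in> X" "norm (u - x1) \<le> D"
    and pos: "\<beta> > 0" "G \<ge> 0" "L > 0"
    and bound: "\<And>t. t \<in> {1..T} \<Longrightarrow> norm (h t) \<le> G"
    and loss: "\<And>t. t \<in> {1..T} \<Longrightarrow>
      l t (x t) - l t u \<le> h t \<bullet> (x t - u) - \<beta> / 2 * (h t \<bullet> (x t - u))\<^sup>2"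
    and smooth: "\<And>t y z. t \<in> {1..T} \<Longrightarrow> y \<in> X \<Longrightarrow> z \<in> X \<Longrightarrow> norm (F t y - F t z) \<le> L * norm (y - z)"
    and V: "\<And>t. t \<in> {1..T} \<Longrightarrow> 0 \<le> V t"
      "\<And>t y. t \<in> {2..T} \<Longrightarrow> y \<in> X \<Longrightarrow> (norm (F t y - F (t - 1) y))\<^sup>2 \<le> V t"
  shows "(\<Sum>t=1..T. l t (x t) - l t u)
    \<le> 16 * n / \<beta> * ln (\<beta> / n * (\<Sum>t=1..T. (norm (h t - F t (x t)))\<^sup>2)
          + \<beta> / (2 * n) * (\<Sum>t=1..T. V t) + \<beta> / (8 * n) * G\<^sup>2 + 1)
      + 16 * n / \<beta> * ln (32 * L\<^sup>2 + 1) + D\<^sup>2 * (1 + \<beta> / 2 * G\<^sup>2)"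
proof -
  have n: "n > 0" by (simp add: n_def)
  define v where "v t = h t - (if t = 1 then 0 else h (t - 1))" for t
  define E where "E t = (norm (h t - F t (x t)))\<^sup>2" for t
  define S where "S k = (\<Sum>t=2..k. (norm (x t - x (t - 1)))\<^sup>2)" for k
  have S0: "S T \<ge> 0" by (simp add: S_def sum_nonneg)
  have E0: "E t \<ge> 0" for t by (simp add: E_def)
  have v_le: "(norm (v (Suc t)))\<^sup>2 \<le> 4 * E (Suc t) + 4 * E t + 4 * V (Suc t) + 4 * L\<^sup>2 * (norm (x (Suc t) - x t))\<^sup>2"
    if "1 \<le> t" "Suc t \<le> T" for t
  proof -
    have xt: "x t \<in> X" "x (Suc t) \<in> X"
      using oomd_run_mem(1)[OF run X(3)] that by auto
    let ?a = "h (Suc t) - F (Suc t) (x (Suc t))" and ?b = "F (Suc t) (x (Suc t)) - F (Suc t) (x t)"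
    let ?c = "F (Suc t) (x t) - F t (x t)" and ?d = "F t (x t) - h t"
    \<comment> \<open>New noise, movement of the decision, change of the mean gradient, and old
      noise. Two uses of the parallelogram-type bound give the factor 4.\<close>
    have "v (Suc t) = (?a + ?b) + (?c + ?d)" using that by (simp add: v_def)
    then have "(norm (v (Suc t)))\<^sup>2 \<le> 2 * (norm (?a + ?b))\<^sup>2 + 2 * (norm (?c + ?d))\<^sup>2"
      by (metis norm_add_power2_le)
    also have "\<dots> \<le> 4 * (norm ?a)\<^sup>2 + 4 * (norm ?b)\<^sup>2 + 4 * (norm ?c)\<^sup>2 + 4 * (norm ?d)\<^sup>2"
      using norm_add_power2_le[of ?a ?b] norm_add_power2_le[of ?c ?d] by linarith
    also have "(norm ?b)\<^sup>2 \<le> (L * norm (x (Suc t) - x t))\<^sup>2"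
      using smooth[of "Suc t"] xt that by (intro power_mono) auto
    also have "(norm ?c)\<^sup>2 \<le> V (Suc t)" using V(2)[of "Suc t" "x t"] xt that by simp
    finally show ?thesis by (simp add: E_def norm_minus_commute power_mult_distrib)
  qed
  \<comment> \<open>Each noise term occurs as new and as old noise, hence 8. The summand
    \<open>4 * E k\<close> on the left reserves the part that round \<open>k + 1\<close> will
    use.\<close>
  have sum_v: "(\<Sum>t=1..k. (norm (v t))\<^sup>2) + 4 * E k
      \<le> G\<^sup>2 + 8 * (\<Sum>t=1..k. E t) + 4 * (\<Sum>t=1..k. V t) + 4 * L\<^sup>2 * S k" if "1 \<le> k" "k \<le> T" for k
    using that
  proof (induction k rule: nat_induct_at_least)
    case base
    have "(norm (v 1))\<^sup>2 \<le> G\<^sup>2"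
      using bound[of 1] \<open>T \<ge> 1\<close> by (intro power_mono) (auto simp: v_def)
    then show ?case using V(1)[of 1] \<open>T \<ge> 1\<close> E0[of 1] by (simp add: S_def)
  next
    case (Suc k)
    have "S (Suc k) = S k + (norm (x (Suc k) - x k))\<^sup>2" using Suc by (simp add: S_def)
    then show ?case using Suc v_le[of k] by (simp add: distrib_left)
  qed
  define P where "P = \<beta> / n * (\<Sum>t=1..T. E t) + \<beta> / (2 * n) * (\<Sum>t=1..T. V t) + \<beta> / (8 * n) * G\<^sup>2 + 1"
  define q where "q = \<beta> * L\<^sup>2 / (2 * n) * S T"
  have P: "P \<ge> 1" using pos n E0 V(1) unfolding P_def
    by (auto intro!: add_nonneg_nonneg divide_nonneg_pos mult_nonneg_nonneg sum_nonneg)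
  have q: "q \<ge> 0" using pos n S0 by (simp add: q_def)
  have "1 + \<beta> / (8 * n) * (\<Sum>t=1..T. (norm (v t))\<^sup>2)
      \<le> 1 + \<beta> / (8 * n) * (G\<^sup>2 + 8 * (\<Sum>t=1..T. E t) + 4 * (\<Sum>t=1..T. V t) + 4 * L\<^sup>2 * S T)"
    using sum_v[of T] E0[of T] \<open>T \<ge> 1\<close> pos n by (intro add_left_mono mult_left_mono) auto
  also have "\<dots> = P + q" using n by (simp add: P_def q_def field_simps)
  \<comment> \<open>Turning the sum into a product separates the movement \<open>q\<close> from the
    statistical quantities under the logarithm.\<close>
  also have "\<dots> \<le> P * (1 + q)" using P q by (simp add: distrib_left mult_le_cancel_right1)
  finally have "ln (1 + \<beta> / (8 * n) * (\<Sum>t=1..T. (norm (v t))\<^sup>2)) \<le> ln (P * (1 + q))"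
    using pos n by (intro ln_mono) (auto intro!: add_pos_nonneg divide_nonneg_pos mult_nonneg_nonneg sum_nonneg)
  also have "\<dots> = ln P + ln (1 + q)" using P q by (simp add: ln_mult)
  also have "ln (1 + q) \<le> ln (32 * L\<^sup>2 + 1) + \<beta> / (64 * n) * S T"
  proof -
    define K where "K = 32 * L\<^sup>2 + 1"
    have K: "K > 1" using pos by (simp add: K_def)
    have "ln ((1 + q) / K) \<le> (1 + q) / K - 1" using K q by (intro ln_le_minus_one) simp
    also have "\<dots> \<le> q / K" using K by (simp add: field_simps)
    also have "\<dots> \<le> q / (32 * L\<^sup>2)" using q pos K
      by (intro divide_left_mono mult_pos_pos) (simp_all add: K_def add_nonneg_pos)
    also have "\<dots> = \<beta> / (64 * n) * S T" using pos n by (simp add: q_def field_simps)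
    finally show ?thesis using K q by (simp add: ln_div K_def[symmetric])
  qed
  finally have "16 * n / \<beta> * ln (1 + \<beta> / (8 * n) * (\<Sum>t=1..T. (norm (v t))\<^sup>2))
      \<le> 16 * n / \<beta> * (ln P + (ln (32 * L\<^sup>2 + 1) + \<beta> / (64 * n) * S T))"
    using pos n by (intro mult_left_mono) auto
  also have "\<dots> = 16 * n / \<beta> * ln P + 16 * n / \<beta> * ln (32 * L\<^sup>2 + 1) + 1 / 4 * S T"
    using pos n by (simp add: distrib_left)
  finally show ?thesis
    using oomd_regret[OF run X pos(1,2) bound[unfolded h_def] loss[unfolded h_def]]
    unfolding P_def E_def S_def v_def h_def n_def by linarith
qed

section \<open>Measurability and the conditional law\<close>

lemma closure_approx_continuous:
  fixes f :: "'a::metric_space \<Rightarrow> real"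
  assumes "continuous_on S f" "P \<subseteq> S" "s \<in> S" "s \<in> closure P" "e > 0"
  shows "\<exists>p\<in>P. \<bar>f p - f s\<bar> < e"
proof -
  obtain d where "d > 0" "\<And>p. p \<in> S \<Longrightarrow> dist p s < d \<Longrightarrow> dist (f p) (f s) < e"
    using assms(1,3,5) unfolding continuous_on_iff by metis
  moreover from \<open>d > 0\<close> obtain p where "p \<in> P" "dist p s < d"
    using assms(4) by (auto simp: closure_approachable)
  ultimately show ?thesis using assms(2) by (auto simp: dist_real_def)
qed

text \<open>Minimising over a closed set and over \<open>X\<close> can both be done along countable dense
  subsets, so no measurable selection theorem is needed.\<close>

lemma borel_measurable_unique_arg_min:
  fixes \<Phi> :: "'w \<Rightarrow> 'a::euclidean_space \<Rightarrow> real"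
  assumes "compact X"
    and meas: "\<And>y. y \<in> X \<Longrightarrow> (\<lambda>\<omega>. \<Phi> \<omega> y) \<in> borel_measurable F"
    and cont: "\<And>\<omega>. \<omega> \<in> space F \<Longrightarrow> continuous_on X (\<Phi> \<omega>)"
    and z: "\<And>\<omega>. \<omega> \<in> space F \<Longrightarrow> z \<omega> \<in> X"
    and min: "\<And>\<omega> y. \<omega> \<in> space F \<Longrightarrow> y \<in> X \<Longrightarrow> y \<noteq> z \<omega> \<Longrightarrow> \<Phi> \<omega> (z \<omega>) < \<Phi> \<omega> y"
  shows "z \<in> borel_measurable F"
proof (rule borel_measurableI)
  fix U :: "'a set" assume "open U"
  define K where "K = X - U"
  have K: "compact K" "K \<subseteq> X"
    using assms(1) \<open>open U\<close> by (auto simp: K_def compact_diff)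
  obtain P where P: "countable P" "P \<subseteq> K" "K \<subseteq> closure P" by (rule separable)
  obtain Q where Q: "countable Q" "Q \<subseteq> X" "X \<subseteq> closure Q" by (rule separable)
  \<comment> \<open>The event that the infimum over \<open>K\<close> does not exceed the one over
    \<open>X\<close>. Compactness yields a minimiser in \<open>K\<close>, and uniqueness identifies
    it with \<open>z \<omega>\<close>.\<close>
  let ?B = "{\<omega> \<in> space F. \<forall>q\<in>Q. \<forall>n::nat. \<exists>p\<in>P. \<Phi> \<omega> p < \<Phi> \<omega> q + 1 / (1 + real n)}"
  have "z \<omega> \<in> K \<longleftrightarrow> (\<forall>q\<in>Q. \<forall>n::nat. \<exists>p\<in>P. \<Phi> \<omega> p < \<Phi> \<omega> q + 1 / (1 + real n))"
    if \<omega>: "\<omega> \<in> space F" for \<omega>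
  proof
    assume zK: "z \<omega> \<in> K"
    show "\<forall>q\<in>Q. \<forall>n::nat. \<exists>p\<in>P. \<Phi> \<omega> p < \<Phi> \<omega> q + 1 / (1 + real n)"
    proof (intro ballI allI)
      fix q and n :: nat assume "q \<in> Q"
      then have "\<Phi> \<omega> (z \<omega>) \<le> \<Phi> \<omega> q" using min[OF \<omega>, of q] Q by (cases "q = z \<omega>") auto
      moreover obtain p where "p \<in> P" "\<bar>\<Phi> \<omega> p - \<Phi> \<omega> (z \<omega>)\<bar> < 1 / (1 + real n)"
        using closure_approx_continuous[OF cont[OF \<omega>], of P "z \<omega>" "1 / (1 + real n)"] P K zK by auto
      ultimately show "\<exists>p\<in>P. \<Phi> \<omega> p < \<Phi> \<omega> q + 1 / (1 + real n)" by (intro bexI[of _ p]) auto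
    qed
  next
    assume *: "\<forall>q\<in>Q. \<forall>n::nat. \<exists>p\<in>P. \<Phi> \<omega> p < \<Phi> \<omega> q + 1 / (1 + real n)"
    have "z \<omega> \<in> closure Q" using z[OF \<omega>] Q by auto
    then have "Q \<noteq> {}" by auto
    then have "K \<noteq> {}" using * P by blast
    then obtain k where k: "k \<in> K" "\<And>p. p \<in> K \<Longrightarrow> \<Phi> \<omega> k \<le> \<Phi> \<omega> p"
      using continuous_attains_inf[OF K(1)] continuous_on_subset[OF cont[OF \<omega>] K(2)] by metis
    have "\<Phi> \<omega> k \<le> \<Phi> \<omega> (z \<omega>) + e" if "e > 0" for e
    proof -
      have "z \<omega> \<in> closure Q" using z[OF \<omega>] Q by auto
      then obtain q where q: "q \<in> Q" "\<bar>\<Phi> \<omega> q - \<Phi> \<omega> (z \<omega>)\<bar> < e / 2"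
        using closure_approx_continuous[OF cont[OF \<omega>] Q(2) z[OF \<omega>], of "e / 2"] \<open>e > 0\<close>
        by (meson half_gt_zero)
      obtain n where "inverse (real (Suc n)) < e / 2"
        using reals_Archimedean[of "e / 2"] \<open>e > 0\<close> by auto
      then have "1 / (1 + real n) < e / 2" by (simp add: inverse_eq_divide)
      moreover obtain p where "p \<in> P" "\<Phi> \<omega> p < \<Phi> \<omega> q + 1 / (1 + real n)" using * q by blast
      moreover from \<open>p \<in> P\<close> have "\<Phi> \<omega> k \<le> \<Phi> \<omega> p" using k P by auto
      ultimately show ?thesis using q by linarith
    qed
    then have "\<Phi> \<omega> k \<le> \<Phi> \<omega> (z \<omega>)" by (rule field_le_epsilon)
    then have "k = z \<omega>" using min[OF \<omega>, of k] k K by force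
    then show "z \<omega> \<in> K" using k by simp
  qed
  then have "z -` U \<inter> space F = space F - ?B"
    using z by (auto simp: K_def)
  moreover have "?B \<in> sets F"
  proof -
    have "Measurable.pred F (\<lambda>\<omega>. \<Phi> \<omega> p < \<Phi> \<omega> q + 1 / (1 + real n))" if "p \<in> P" "q \<in> Q" for p q n
    proof -
      have [measurable]: "(\<lambda>\<omega>. \<Phi> \<omega> p) \<in> borel_measurable F" "(\<lambda>\<omega>. \<Phi> \<omega> q) \<in> borel_measurable F"
        using meas that P Q K by auto
      show ?thesis by measurable
    qed
    then show ?thesis
      using P(1) Q(1) unfolding pred_def
      by (intro sets.sets_Collect_countable_All' sets.sets_Collect_countable_All
          sets.sets_Collect_countable_Ex') auto
  qed
  ultimately show "z -` U \<inter> space F \<in> sets F" by auto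
qed

section \<open>Information of the past and the conditional law\<close>

context sea_model
begin

abbreviation "\<F> t \<equiv> past M N \<DD> f t"

lemma sets_past: "sets (\<F> t) = sigma_sets (space M)
    ((\<Union>s\<in>{1..<t}. {f s -` A \<inter> space M | A. A \<in> sets N}) \<union>
     (\<Union>s\<in>{1..t}. {\<DD> s -` B \<inter> space M | B. B \<in> sets (prob_algebra N)}))"
  unfolding past_def by (rule sets_measure_of) auto

lemma space_past: "space (\<F> t) = space M"
  unfolding past_def by (rule space_measure_of) auto

lemma subalgebra_past:
  assumes "t \<in> {1..T}"
  shows "subalgebra M (\<F> t)"
  unfolding subalgebra_def space_past sets_past
  using assms by (auto intro!: sets.sigma_sets_subset measurable_sets[OF loss_measurable]
      measurable_sets[OF distribution_measurable])

lemma loss_measurable_past: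
  assumes "t \<in> {1..T}" "s \<in> {1..<t}"
  shows "f s \<in> \<F> t \<rightarrow>\<^sub>M N"
proof (rule measurableI)
  show "f s \<omega> \<in> space N" if "\<omega> \<in> space (\<F> t)" for \<omega>
    using measurable_space[OF loss_measurable] assms that by (auto simp: space_past)
  show "f s -` A \<inter> space (\<F> t) \<in> sets (\<F> t)" if "A \<in> sets N" for A
    using assms that unfolding space_past sets_past by (intro sigma_sets.Basic) auto
qed

lemma distribution_measurable_past:
  assumes "t \<in> {1..T}"
  shows "\<DD> t \<in> \<F> t \<rightarrow>\<^sub>M prob_algebra N"
proof (rule measurableI)
  show "\<DD> t \<omega> \<in> space (prob_algebra N)" if "\<omega> \<in> space (\<F> t)" for \<omega>
    using measurable_space[OF distribution_measurable] assms that by (auto simp: space_past)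
  show "\<DD> t -` A \<inter> space (\<F> t) \<in> sets (\<F> t)" if "A \<in> sets (prob_algebra N)" for A
    using assms that unfolding space_past sets_past by (intro sigma_sets.Basic UnI2 UN_I[of t]) auto
qed

lemma distributionD:
  assumes "t \<in> {1..T}" "\<omega> \<in> space M"
  shows "prob_space (\<DD> t \<omega>)" "sets (\<DD> t \<omega>) = sets N"
  using measurable_space[OF distribution_measurable[OF assms(1)] assms(2)]
  by (auto simp: space_prob_algebra)

text \<open>Conditionally on the past, \<open>Y\<close> may be frozen while the loss is averaged
  under \<open>\<DD> t \<omega>\<close>. Both sides are integrals over measures on the product
  space, which agree once they agree on rectangles; a rectangle involves one event \<open>A\<close>
  only, so the null set in \<open>conditional_law\<close> may depend on \<open>A\<close>.\<close>

lemma nn_integral_conditional_law: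
  assumes t: "t \<in> {1..T}"
    and Y: "Y \<in> \<F> t \<rightarrow>\<^sub>M S"
    and \<psi>: "\<psi> \<in> borel_measurable (N \<Otimes>\<^sub>M S)"
  shows "(\<integral>\<^sup>+\<omega>. \<psi> (f t \<omega>, Y \<omega>) \<partial>M) = (\<integral>\<^sup>+\<omega>. \<integral>\<^sup>+h. \<psi> (h, Y \<omega>) \<partial>(\<DD> t \<omega>) \<partial>M)"
proof -
  interpret sub: finite_measure_subalgebra M "\<F> t"
    by unfold_locales (rule subalgebra_past[OF t])
  have [measurable]: "Y \<in> M \<rightarrow>\<^sub>M S" using measurable_from_subalg[OF subalgebra_past[OF t] Y] .
  have [measurable]: "f t \<in> M \<rightarrow>\<^sub>M N" using loss_measurable t by auto
  have [measurable]: "\<DD> t \<in> M \<rightarrow>\<^sub>M subprob_algebra N"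
    using distribution_measurable[OF t] by (rule measurable_prob_algebraD)
  note \<psi>[measurable]
  define \<kappa> where "\<kappa> \<omega> = distr (\<DD> t \<omega>) (N \<Otimes>\<^sub>M S) (\<lambda>h. (h, Y \<omega>))" for \<omega>
  have \<kappa>[measurable]: "\<kappa> \<in> M \<rightarrow>\<^sub>M subprob_algebra (N \<Otimes>\<^sub>M S)"
    unfolding \<kappa>_def by (rule measurable_distr2[where M=N]) measurable
  have D_meas: "(\<lambda>h. (h, Y \<omega>)) \<in> \<DD> t \<omega> \<rightarrow>\<^sub>M N \<Otimes>\<^sub>M S" if "\<omega> \<in> space M" for \<omega>
    using that measurable_space[OF \<open>Y \<in> M \<rightarrow>\<^sub>M S\<close>]
    by (simp add: measurable_cong_sets[OF distributionD(2)[OF t that] refl])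
  have "distr M (N \<Otimes>\<^sub>M S) (\<lambda>\<omega>. (f t \<omega>, Y \<omega>)) = M \<bind> \<kappa>"
  proof (rule measure_eqI_generator_eq[OF Int_stable_pair_measure_generator[of N S]])
    show "{a \<times> b |a b. a \<in> sets N \<and> b \<in> sets S} \<subseteq> Pow (space N \<times> space S)"
      by (auto dest: sets.sets_into_space)
    show "sets (distr M (N \<Otimes>\<^sub>M S) (\<lambda>\<omega>. (f t \<omega>, Y \<omega>)))
        = sigma_sets (space N \<times> space S) {a \<times> b |a b. a \<in> sets N \<and> b \<in> sets S}"
      by (simp add: sets_pair_measure)
    show "sets (M \<bind> \<kappa>) = sigma_sets (space N \<times> space S) {a \<times> b |a b. a \<in> sets N \<and> b \<in> sets S}"
      by (simp add: sets_bind[where N="N \<Otimes>\<^sub>M S"] \<kappa>_def not_empty sets_pair_measure)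
    show "range (\<lambda>_::nat. space N \<times> space S) \<subseteq> {a \<times> b |a b. a \<in> sets N \<and> b \<in> sets S}" by auto
    show "(\<Union>i::nat. space N \<times> space S) = space N \<times> space S" by simp
    show "emeasure (distr M (N \<Otimes>\<^sub>M S) (\<lambda>\<omega>. (f t \<omega>, Y \<omega>))) (space N \<times> space S) \<noteq> \<infinity>" for i :: nat
      by (simp add: emeasure_distr)
    fix Z assume "Z \<in> {a \<times> b |a b. a \<in> sets N \<and> b \<in> sets S}"
    then obtain A B where Z: "Z = A \<times> B" and [measurable]: "A \<in> sets N" "B \<in> sets S" by auto
    define C where "C = Y -` B \<inter> space M"
    have C: "C \<in> sets (\<F> t)" using measurable_sets[OF Y, of B] by (simp add: C_def space_past)
    then have [measurable]: "C \<in> sets M" by (simp add: C_def)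
    have "emeasure (distr M (N \<Otimes>\<^sub>M S) (\<lambda>\<omega>. (f t \<omega>, Y \<omega>))) Z = emeasure M ((f t -` A \<inter> space M) \<inter> C)"
      by (subst emeasure_distr) (auto simp: Z C_def intro!: arg_cong[where f="emeasure M"])
    also have "\<dots> = ennreal (\<integral>\<omega>\<in>C. indicat_real A (f t \<omega>) \<partial>M)"
    proof -
      have "(\<integral>\<omega>\<in>C. indicat_real A (f t \<omega>) \<partial>M) = (\<integral>\<omega>. indicator ((f t -` A \<inter> space M) \<inter> C) \<omega> \<partial>M)"
        unfolding set_lebesgue_integral_def
        by (intro Bochner_Integration.integral_cong) (auto simp: indicator_def)
      then show ?thesis by (simp add: emeasure_eq_measure)
    qed
    \<comment> \<open>The defining property of conditional expectation, available because
      \<open>C\<close> is an event of the past.\<close>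
    also have "(\<integral>\<omega>\<in>C. indicat_real A (f t \<omega>) \<partial>M) = (\<integral>\<omega>\<in>C. real_cond_exp M (\<F> t) (\<lambda>\<omega>. indicator A (f t \<omega>)) \<omega> \<partial>M)"
      using C by (intro sub.real_cond_exp_intA integrable_const_bound[where B=1]) auto
    also have "\<dots> = (\<integral>\<omega>\<in>C. measure (\<DD> t \<omega>) A \<partial>M)"
      using conditional_law[OF t \<open>A \<in> sets N\<close>]
      by (intro set_lebesgue_integral_cong_AE) auto
    also have "ennreal \<dots> = (\<integral>\<^sup>+\<omega>. ennreal (indicator C \<omega> * measure (\<DD> t \<omega>) A) \<partial>M)"
      unfolding set_lebesgue_integral_def
      by (subst nn_integral_eq_integral)
        (auto intro!: integrable_const_bound[where B=1] AE_I2 prob_space.prob_le_1 distributionD[OF t] simp: indicator_def)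
    also have "\<dots> = (\<integral>\<^sup>+\<omega>. emeasure (\<kappa> \<omega>) Z \<partial>M)"
    proof (rule nn_integral_cong)
      fix \<omega> assume \<omega>: "\<omega> \<in> space M"
      interpret D: prob_space "\<DD> t \<omega>" by (rule distributionD(1)[OF t \<omega>])
      have "emeasure (\<kappa> \<omega>) Z = emeasure (\<DD> t \<omega>) ((\<lambda>h. (h, Y \<omega>)) -` Z \<inter> space (\<DD> t \<omega>))"
        unfolding \<kappa>_def using D_meas[OF \<omega>] by (subst emeasure_distr) (auto simp: Z)
      also have "(\<lambda>h. (h, Y \<omega>)) -` Z \<inter> space (\<DD> t \<omega>) = (if \<omega> \<in> C then A else {})"
        using \<omega> sets.sets_into_space[OF \<open>A \<in> sets N\<close>] sets_eq_imp_space_eq[OF distributionD(2)[OF t \<omega>]]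
        by (auto simp: Z C_def)
      finally show "ennreal (indicator C \<omega> * measure (\<DD> t \<omega>) A) = emeasure (\<kappa> \<omega>) Z"
        by (simp add: D.emeasure_eq_measure)
    qed
    also have "\<dots> = emeasure (M \<bind> \<kappa>) Z"
      by (subst emeasure_bind[where N="N \<Otimes>\<^sub>M S"]) (auto simp: not_empty Z)
    finally show "emeasure (distr M (N \<Otimes>\<^sub>M S) (\<lambda>\<omega>. (f t \<omega>, Y \<omega>))) Z = emeasure (M \<bind> \<kappa>) Z" .
  qed
  moreover have "(\<integral>\<^sup>+\<omega>. \<psi> (f t \<omega>, Y \<omega>) \<partial>M) = (\<integral>\<^sup>+p. \<psi> p \<partial>distr M (N \<Otimes>\<^sub>M S) (\<lambda>\<omega>. (f t \<omega>, Y \<omega>)))"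
    by (simp add: nn_integral_distr)
  moreover have "(\<integral>\<^sup>+p. \<psi> p \<partial>(M \<bind> \<kappa>)) = (\<integral>\<^sup>+\<omega>. \<integral>\<^sup>+p. \<psi> p \<partial>\<kappa> \<omega> \<partial>M)"
    by (rule nn_integral_bind) measurable
  moreover have "\<dots> = (\<integral>\<^sup>+\<omega>. \<integral>\<^sup>+h. \<psi> (h, Y \<omega>) \<partial>(\<DD> t \<omega>) \<partial>M)"
    unfolding \<kappa>_def using D_meas by (intro nn_integral_cong nn_integral_distr) auto
  ultimately show ?thesis by simp
qed

end

text \<open>The matrices dominate the identity, so the three-point inequality leaves a positive gap.
  This is the uniqueness on which measurability of the iterates rests.\<close>

lemma oomd_objective_strict_min:
  assumes "convex X" "\<beta> \<ge> 0" "y \<in> X" "y \<noteq> z"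
    and min: "is_arg_min (oomd_objective v (oomd_matrix \<beta> G g t) c) (\<lambda>z. z \<in> X) z"
  shows "oomd_objective v (oomd_matrix \<beta> G g t) c z < oomd_objective v (oomd_matrix \<beta> G g t) c y"
proof -
  let ?H = "oomd_matrix \<beta> G g t"
  have "0 < (1 + \<beta> / 2 * G\<^sup>2) * (norm (y - z))\<^sup>2"
    using assms by (intro mult_pos_pos add_pos_nonneg) auto
  also have "\<dots> \<le> mat_norm_sq ?H (y - z)" using assms(2) by (rule mat_norm_sq_oomd_matrix_ge)
  finally have "0 < mat_norm_sq ?H (y - z)" .
  moreover have "v \<bullet> (z - y) \<le> 1 / 2 * (mat_norm_sq ?H (y - c) - mat_norm_sq ?H (y - z) - mat_norm_sq ?H (z - c))"
    by (rule arg_min_three_point[OF oomd_matrix_symmetric assms(1,3) min])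
  ultimately show ?thesis by (simp add: oomd_objective_def inner_diff_right)
qed

lemma borel_measurable_oomd_arg_min:
  fixes v c z :: "'w \<Rightarrow> real ^ 'd"
  assumes "compact X" "convex X" "\<beta> \<ge> 0"
    and [measurable]: "v \<in> borel_measurable F" "c \<in> borel_measurable F"
      "\<And>s. s \<in> {1..<t} \<Longrightarrow> (\<lambda>\<omega>. g \<omega> s) \<in> borel_measurable F"
    and min: "\<And>\<omega>. \<omega> \<in> space F \<Longrightarrow>
      is_arg_min (oomd_objective (v \<omega>) (oomd_matrix \<beta> G (g \<omega>) t) (c \<omega>)) (\<lambda>z. z \<in> X) (z \<omega>)"
  shows "z \<in> borel_measurable F"
proof (rule borel_measurable_unique_arg_min[OF assms(1)])
  show "(\<lambda>\<omega>. oomd_objective (v \<omega>) (oomd_matrix \<beta> G (g \<omega>) t) (c \<omega>) y) \<in> borel_measurable F" for y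
    unfolding oomd_objective_def mat_norm_sq_oomd_matrix by measurable
  show "continuous_on X (oomd_objective (v \<omega>) (oomd_matrix \<beta> G (g \<omega>) t) (c \<omega>))" for \<omega>
    unfolding oomd_objective_def mat_norm_sq_oomd_matrix by (intro continuous_intros)
  show "z \<omega> \<in> X" if "\<omega> \<in> space F" for \<omega>
    using min[OF that] by (simp add: is_arg_min_def)
  show "oomd_objective (v \<omega>) (oomd_matrix \<beta> G (g \<omega>) t) (c \<omega>) (z \<omega>)
      < oomd_objective (v \<omega>) (oomd_matrix \<beta> G (g \<omega>) t) (c \<omega>) y"
    if "\<omega> \<in> space F" "y \<in> X" "y \<noteq> z \<omega>" for \<omega> y
    using oomd_objective_strict_min[OF assms(2,3) that(2,3) min[OF that(1)]] .
qed

section \<open>Adaptedness of the iterates and of the mean gradients\<close>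

context sea_model
begin

lemma borel_measurable_grad_compose:
  assumes "p \<in> K \<rightarrow>\<^sub>M N" "y \<in> borel_measurable K" "\<And>\<omega>. \<omega> \<in> space K \<Longrightarrow> y \<omega> \<in> X"
  shows "(\<lambda>\<omega>. grad (p \<omega>) (y \<omega>)) \<in> borel_measurable K"
proof -
  have "(\<lambda>\<omega>. (p \<omega>, y \<omega>)) \<in> K \<rightarrow>\<^sub>M N \<Otimes>\<^sub>M restrict_space borel X"
    using assms by (intro measurable_Pair measurable_restrict_space2) auto
  from measurable_compose[OF this grad_measurable] show ?thesis by simp
qed

lemma oomd_run_measurable_past:
  assumes X: "compact X" "x1 \<in> X" and "\<beta> \<ge> 0"
    and run: "\<And>\<omega>. \<omega> \<in> space M \<Longrightarrow> oomd_run T X grad \<beta> G x1 (\<lambda>t. f t \<omega>) (\<lambda>t. x t \<omega>) (\<lambda>t. xh t \<omega>)"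
    and t: "t \<in> {1..T}" and "s \<in> {1..t}"
  shows "x s \<in> borel_measurable (\<F> t)" "xh s \<in> borel_measurable (\<F> t)"
proof -
  have mem: "x s \<omega> \<in> X" if "s \<in> {1..t}" "\<omega> \<in> space M" for s \<omega>
    using oomd_run_mem(1)[OF run[OF that(2)] X(2)] that t by auto
  have "x s \<in> borel_measurable (\<F> t) \<and> xh s \<in> borel_measurable (\<F> t)"
    using \<open>s \<in> {1..t}\<close>
  proof (induction s rule: less_induct)
    case (less s)
    show ?case
    proof (cases "s = 1")
      case True
      have "x s \<omega> = x1" "xh s \<omega> = x1" if "\<omega> \<in> space (\<F> t)" for \<omega>
        using run[of \<omega>] that True by (auto simp: oomd_run_def Let_def space_past)
      then show ?thesis
        using measurable_cong[of "\<F> t" "x s" "\<lambda>_. x1" borel] measurable_cong[of "\<F> t" "xh s" "\<lambda>_. x1" borel]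
        by simp
    next
      case False
      \<comment> \<open>Both minimisations that produce round \<open>s\<close> use gradients up to
        round \<open>r\<close> only, since \<open>oomd_matrix\<close> at \<open>s\<close> sums over
        smaller indices. \<open>xh s\<close> comes first, being the centre of the objective for
        \<open>x s\<close>.\<close>
      define r where "r = s - 1"
      have r: "s = r + 1" "r \<in> {1..T}" "r < t" "1 \<le> r" using False less.prems t by (auto simp: r_def)
      have g: "(\<lambda>\<omega>. grad (f k \<omega>) (x k \<omega>)) \<in> borel_measurable (\<F> t)" if "k \<in> {1..r}" for k
        using less.IH[of k] that r t mem
        by (intro borel_measurable_grad_compose loss_measurable_past) (auto simp: space_past)
      have min: "is_arg_min (oomd_objective (grad (f r \<omega>) (x r \<omega>))
            (oomd_matrix \<beta> G (\<lambda>t. grad (f t \<omega>) (x t \<omega>)) r) (xh r \<omega>)) (\<lambda>z. z \<in> X) (xh s \<omega>)"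
        "is_arg_min (oomd_objective (grad (f r \<omega>) (x r \<omega>))
            (oomd_matrix \<beta> G (\<lambda>t. grad (f t \<omega>) (x t \<omega>)) s) (xh s \<omega>)) (\<lambda>z. z \<in> X) (x s \<omega>)"
        if "\<omega> \<in> space (\<F> t)" for \<omega>
        using run[of \<omega>] that r unfolding oomd_run_def Let_def by (auto simp: space_past)
      have "xh r \<in> borel_measurable (\<F> t)" using less.IH[of r] r by auto
      then have xh: "xh s \<in> borel_measurable (\<F> t)"
        using g r min(1) \<open>\<beta> \<ge> 0\<close>
        by (intro borel_measurable_oomd_arg_min[OF X(1) domain(3), where z="xh s"
            and v="\<lambda>\<omega>. grad (f r \<omega>) (x r \<omega>)" and g="\<lambda>\<omega> t. grad (f t \<omega>) (x t \<omega>)" and t=r]) auto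
      moreover have "x s \<in> borel_measurable (\<F> t)"
        using g r min(2) \<open>\<beta> \<ge> 0\<close> xh
        by (intro borel_measurable_oomd_arg_min[OF X(1) domain(3), where z="x s"
            and v="\<lambda>\<omega>. grad (f r \<omega>) (x r \<omega>)" and g="\<lambda>\<omega> t. grad (f t \<omega>) (x t \<omega>)" and t=s]) auto
      ultimately show ?thesis by simp
    qed
  qed
  then show "x s \<in> borel_measurable (\<F> t)" "xh s \<in> borel_measurable (\<F> t)" by auto
qed

lemma mean_grad_eq:
  assumes "t \<in> {1..T}" "\<omega> \<in> space M" "y \<in> X"
  shows "mean_grad grad \<DD> t \<omega> y = (\<integral>h. grad h y \<partial>\<DD> t \<omega>)"
  using assms interchange[OF assms] by (auto simp: mean_grad_def)

text \<open>The mean gradient at a random point is the integral of \<open>grad\<close> against a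
  random measure on pairs. It belongs to the past of round \<open>t\<close> because that past
  contains the distribution of round \<open>t\<close>.\<close>

lemma borel_measurable_mean_grad_compose:
  assumes t: "t \<in> {1..T}" and y: "y \<in> borel_measurable (\<F> t)" "\<And>\<omega>. \<omega> \<in> space M \<Longrightarrow> y \<omega> \<in> X"
  shows "(\<lambda>\<omega>. mean_grad grad \<DD> t \<omega> (y \<omega>)) \<in> borel_measurable (\<F> t)"
proof -
  let ?R = "restrict_space borel X :: (real ^ 'd) measure"
  have yR[measurable]: "y \<in> \<F> t \<rightarrow>\<^sub>M ?R"
    using y by (intro measurable_restrict_space2) (auto simp: space_past)
  have [measurable]: "\<DD> t \<in> \<F> t \<rightarrow>\<^sub>M subprob_algebra N"
    using distribution_measurable_past[OF t] by (rule measurable_prob_algebraD)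
  note grad_measurable[measurable]
  have "(\<lambda>\<omega>. distr (\<DD> t \<omega>) (N \<Otimes>\<^sub>M ?R) (\<lambda>h. (h, y \<omega>))) \<in> \<F> t \<rightarrow>\<^sub>M subprob_algebra (N \<Otimes>\<^sub>M ?R)"
    by (rule measurable_distr2[where M=N]) measurable
  from measurable_compose[OF this integral_measurable_subprob_algebra[OF grad_measurable]]
  have "(\<lambda>\<omega>. \<integral>p. (case p of (h, z) \<Rightarrow> grad h z) \<partial>distr (\<DD> t \<omega>) (N \<Otimes>\<^sub>M ?R) (\<lambda>h. (h, y \<omega>))) \<in> borel_measurable (\<F> t)" .
  also have "?this \<longleftrightarrow> ?thesis"
  proof (rule measurable_cong)
    fix \<omega> assume "\<omega> \<in> space (\<F> t)"
    then have \<omega>: "\<omega> \<in> space M" by (simp add: space_past)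
    have "(\<lambda>h. (h, y \<omega>)) \<in> \<DD> t \<omega> \<rightarrow>\<^sub>M N \<Otimes>\<^sub>M ?R"
      using y(2)[OF \<omega>] by (simp add: measurable_cong_sets[OF distributionD(2)[OF t \<omega>] refl] space_restrict_space)
    from integral_distr[OF this grad_measurable]
    show "(\<integral>p. (case p of (h, z) \<Rightarrow> grad h z) \<partial>distr (\<DD> t \<omega>) (N \<Otimes>\<^sub>M ?R) (\<lambda>h. (h, y \<omega>)))
        = mean_grad grad \<DD> t \<omega> (y \<omega>)"
      unfolding mean_grad_eq[OF t \<omega> y(2)[OF \<omega>]] by simp
  qed
  finally show ?thesis .
qed

end

text \<open>The bound makes both suprema genuine least upper bounds, as a real \<open>SUP\<close>
  over an unbounded set carries no information, and makes them integrable.\<close>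

locale sea_model_bounded_grad = sea_model M T X N grad \<DD> f
  for M :: "'w measure" and T and X :: "(real ^ 'd) set" and N grad \<DD> f +
  fixes G :: real
  assumes AE_grad_bound: "\<And>t \<omega>. t \<in> {1..T} \<Longrightarrow> \<omega> \<in> space M \<Longrightarrow> AE h in \<DD> t \<omega>. \<forall>y\<in>X. norm (grad h y) \<le> G"
    and G_nonneg: "0 \<le> G"
begin

lemma norm_mean_grad_le:
  assumes "t \<in> {1..T}" "\<omega> \<in> space M" "y \<in> X"
  shows "norm (mean_grad grad \<DD> t \<omega> y) \<le> G"
proof -
  interpret D: prob_space "\<DD> t \<omega>" by (rule distributionD(1)[OF assms(1,2)])
  have "norm (\<integral>h. grad h y \<partial>\<DD> t \<omega>) \<le> (\<integral>h. norm (grad h y) \<partial>\<DD> t \<omega>)" by (rule integral_norm_bound)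
  also have "\<dots> \<le> G"
    using AE_grad_bound[OF assms(1,2)] assms(3) grad_integrable[OF assms]
    by (intro D.integral_le_const) auto
  finally show ?thesis by (simp add: mean_grad_eq[OF assms])
qed

lemma grad_diff_mean_grad:
  assumes "t \<in> {1..T}" "\<omega> \<in> space M" "y \<in> X"
  shows "AE h in \<DD> t \<omega>. (norm (grad h y - mean_grad grad \<DD> t \<omega> y))\<^sup>2 \<le> (2 * G)\<^sup>2"
    and "integrable (\<DD> t \<omega>) (\<lambda>h. (norm (grad h y - mean_grad grad \<DD> t \<omega> y))\<^sup>2)"
    and "(\<integral>h. (norm (grad h y - mean_grad grad \<DD> t \<omega> y))\<^sup>2 \<partial>\<DD> t \<omega>) \<le> (2 * G)\<^sup>2"
proof -
  interpret D: prob_space "\<DD> t \<omega>" by (rule distributionD(1)[OF assms(1,2)])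
  show ae: "AE h in \<DD> t \<omega>. (norm (grad h y - mean_grad grad \<DD> t \<omega> y))\<^sup>2 \<le> (2 * G)\<^sup>2"
    using AE_grad_bound[OF assms(1,2)]
  proof eventually_elim
    case (elim h)
    then have "norm (grad h y - mean_grad grad \<DD> t \<omega> y) \<le> 2 * G"
      using norm_triangle_ineq4[of "grad h y" "mean_grad grad \<DD> t \<omega> y"] norm_mean_grad_le[OF assms] assms(3)
      by fastforce
    then show ?case by (intro power_mono) auto
  qed
  have [measurable]: "(\<lambda>h. grad h y) \<in> borel_measurable (\<DD> t \<omega>)"
    using grad_integrable[OF assms] by (rule borel_measurable_integrable)
  show int: "integrable (\<DD> t \<omega>) (\<lambda>h. (norm (grad h y - mean_grad grad \<DD> t \<omega> y))\<^sup>2)"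
    using ae by (intro D.integrable_const_bound[where B="(2 * G)\<^sup>2"]) auto
  show "(\<integral>h. (norm (grad h y - mean_grad grad \<DD> t \<omega> y))\<^sup>2 \<partial>\<DD> t \<omega>) \<le> (2 * G)\<^sup>2"
    using int ae by (rule D.integral_le_const)
qed

lemma grad_variance_bounds:
  assumes "t \<in> {1..T}" "\<omega> \<in> space M"
  shows "y \<in> X \<Longrightarrow> (\<integral>h. (norm (grad h y - mean_grad grad \<DD> t \<omega> y))\<^sup>2 \<partial>\<DD> t \<omega>) \<le> grad_variance X grad \<DD> t \<omega>"
    and "0 \<le> grad_variance X grad \<DD> t \<omega>" "grad_variance X grad \<DD> t \<omega> \<le> (2 * G)\<^sup>2"
proof -
  note b = grad_diff_mean_grad(3)[OF assms]
  show le: "(\<integral>h. (norm (grad h y - mean_grad grad \<DD> t \<omega> y))\<^sup>2 \<partial>\<DD> t \<omega>) \<le> grad_variance X grad \<DD> t \<omega>"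
    if "y \<in> X" for y
    unfolding grad_variance_def using that b by (intro cSUP_upper bdd_aboveI2) auto
  obtain y where y: "y \<in> X" using domain(1) by auto
  have "0 \<le> (\<integral>h. (norm (grad h y - mean_grad grad \<DD> t \<omega> y))\<^sup>2 \<partial>\<DD> t \<omega>)" by simp
  with le[OF y] show "0 \<le> grad_variance X grad \<DD> t \<omega>" by linarith
  show "grad_variance X grad \<DD> t \<omega> \<le> (2 * G)\<^sup>2"
    unfolding grad_variance_def using domain(1) b by (intro cSUP_least) auto
qed

lemma grad_variation_bounds:
  assumes "t \<in> {1..T}" "\<omega> \<in> space M"
  shows "y \<in> X \<Longrightarrow> (norm (mean_grad grad \<DD> t \<omega> y - mean_grad grad \<DD> (t - 1) \<omega> y))\<^sup>2 \<le> grad_variation X grad \<DD> t \<omega>"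
    and "0 \<le> grad_variation X grad \<DD> t \<omega>" "grad_variation X grad \<DD> t \<omega> \<le> (2 * G)\<^sup>2"
proof -
  have b: "(norm (mean_grad grad \<DD> t \<omega> y - mean_grad grad \<DD> (t - 1) \<omega> y))\<^sup>2 \<le> (2 * G)\<^sup>2" if "y \<in> X" for y
  proof (intro power_mono)
    have "norm (mean_grad grad \<DD> (t - 1) \<omega> y) \<le> G"
    proof (cases "t = 1")
      case True
      then show ?thesis using G_nonneg by (simp add: mean_grad_def)
    next
      case False
      then have "t - 1 \<in> {1..T}" using assms by auto
      then show ?thesis using norm_mean_grad_le that assms by blast
    qed
    then show "norm (mean_grad grad \<DD> t \<omega> y - mean_grad grad \<DD> (t - 1) \<omega> y) \<le> 2 * G"
      using norm_triangle_ineq4[of "mean_grad grad \<DD> t \<omega> y" "mean_grad grad \<DD> (t - 1) \<omega> y"]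
        norm_mean_grad_le[OF assms that] by linarith
  qed simp
  show le: "(norm (mean_grad grad \<DD> t \<omega> y - mean_grad grad \<DD> (t - 1) \<omega> y))\<^sup>2 \<le> grad_variation X grad \<DD> t \<omega>"
    if "y \<in> X" for y
    unfolding grad_variation_def using that b by (intro cSUP_upper bdd_aboveI2) auto
  obtain y where y: "y \<in> X" using domain(1) by auto
  show "0 \<le> grad_variation X grad \<DD> t \<omega>" using le[OF y] by (rule order_trans[OF zero_le_power2])
  show "grad_variation X grad \<DD> t \<omega> \<le> (2 * G)\<^sup>2"
    unfolding grad_variation_def using domain(1) b by (intro cSUP_least) auto
qed

lemma integrable_grad_variance: "t \<in> {1..T} \<Longrightarrow> integrable M (grad_variance X grad \<DD> t)"
  using grad_variance_bounds variance_measurable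
  by (intro integrable_const_bound[where B="(2 * G)\<^sup>2"] AE_I2) auto

lemma integrable_grad_variation: "t \<in> {1..T} \<Longrightarrow> integrable M (grad_variation X grad \<DD> t)"
  using grad_variation_bounds variation_measurable
  by (intro integrable_const_bound[where B="(2 * G)\<^sup>2"] AE_I2) auto

text \<open>As \<open>y\<close> is determined by the past, conditioning freezes it; the inner
  integral is then a variance at a fixed point of \<open>X\<close>, which the supremum
  dominates.\<close>

lemma gradient_noise:
  assumes t: "t \<in> {1..T}" and y: "y \<in> borel_measurable (\<F> t)" "\<And>\<omega>. \<omega> \<in> space M \<Longrightarrow> y \<omega> \<in> X"
    and bound: "\<And>\<omega>. \<omega> \<in> space M \<Longrightarrow> norm (grad (f t \<omega>) (y \<omega>)) \<le> G"
  defines "e \<equiv> \<lambda>\<omega>. (norm (grad (f t \<omega>) (y \<omega>) - mean_grad grad \<DD> t \<omega> (y \<omega>)))\<^sup>2"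
  shows "integrable M e" "expectation e \<le> expectation (grad_variance X grad \<DD> t)"
proof -
  let ?R = "restrict_space borel X :: (real ^ 'd) measure"
  have a: "(\<lambda>\<omega>. mean_grad grad \<DD> t \<omega> (y \<omega>)) \<in> borel_measurable (\<F> t)"
    by (rule borel_measurable_mean_grad_compose[OF t y])
  have yM: "y \<in> borel_measurable M"
    and [measurable]: "(\<lambda>\<omega>. mean_grad grad \<DD> t \<omega> (y \<omega>)) \<in> borel_measurable M"
    using measurable_from_subalg[OF subalgebra_past[OF t]] y(1) a by auto
  have [measurable]: "(\<lambda>\<omega>. grad (f t \<omega>) (y \<omega>)) \<in> borel_measurable M"
    using yM y(2) loss_measurable[OF t] by (intro borel_measurable_grad_compose) auto
  have e[measurable]: "e \<in> borel_measurable M" unfolding e_def by measurable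
  have "e \<omega> \<le> (2 * G)\<^sup>2" if "\<omega> \<in> space M" for \<omega>
    unfolding e_def using norm_mean_grad_le[OF t that y(2)[OF that]] bound[OF that]
      norm_triangle_ineq4[of "grad (f t \<omega>) (y \<omega>)" "mean_grad grad \<DD> t \<omega> (y \<omega>)"]
    by (intro power_mono) auto
  then show int: "integrable M e"
    by (intro integrable_const_bound[where B="(2 * G)\<^sup>2"] AE_I2) (auto simp: e_def)
  define \<psi> where "\<psi> = (\<lambda>(h, z, b). ennreal ((norm (grad h z - b :: real ^ 'd))\<^sup>2))"
  \<comment> \<open>The mean gradient is frozen together with the point, so that only the sampled
    gradient is averaged.\<close>
  have Y: "(\<lambda>\<omega>. (y \<omega>, mean_grad grad \<DD> t \<omega> (y \<omega>))) \<in> \<F> t \<rightarrow>\<^sub>M ?R \<Otimes>\<^sub>M borel"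
    using y a by (intro measurable_Pair measurable_restrict_space2) (auto simp: space_past)
  have "(\<lambda>p. (fst p, fst (snd p))) \<in> N \<Otimes>\<^sub>M (?R \<Otimes>\<^sub>M (borel :: (real ^ 'd) measure)) \<rightarrow>\<^sub>M N \<Otimes>\<^sub>M ?R" by measurable
  from measurable_compose[OF this grad_measurable]
  have [measurable]: "(\<lambda>p. grad (fst p) (fst (snd p))) \<in> borel_measurable (N \<Otimes>\<^sub>M (?R \<Otimes>\<^sub>M (borel :: (real ^ 'd) measure)))"
    by simp
  have \<psi>: "\<psi> \<in> borel_measurable (N \<Otimes>\<^sub>M (?R \<Otimes>\<^sub>M borel))"
    unfolding \<psi>_def case_prod_beta by measurable
  have "ennreal (expectation e) = (\<integral>\<^sup>+\<omega>. e \<omega> \<partial>M)"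
    using int by (intro nn_integral_eq_integral[symmetric]) (auto simp: e_def)
  also have "\<dots> = (\<integral>\<^sup>+\<omega>. \<psi> (f t \<omega>, y \<omega>, mean_grad grad \<DD> t \<omega> (y \<omega>)) \<partial>M)"
    by (simp add: \<psi>_def e_def)
  also have "\<dots> = (\<integral>\<^sup>+\<omega>. \<integral>\<^sup>+h. \<psi> (h, y \<omega>, mean_grad grad \<DD> t \<omega> (y \<omega>)) \<partial>\<DD> t \<omega> \<partial>M)"
    using nn_integral_conditional_law[OF t Y \<psi>] by simp
  also have "\<dots> \<le> (\<integral>\<^sup>+\<omega>. grad_variance X grad \<DD> t \<omega> \<partial>M)"
  proof (rule nn_integral_mono)
    fix \<omega> assume \<omega>: "\<omega> \<in> space M"
    have "(\<integral>\<^sup>+h. \<psi> (h, y \<omega>, mean_grad grad \<DD> t \<omega> (y \<omega>)) \<partial>\<DD> t \<omega>)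
        = ennreal (\<integral>h. (norm (grad h (y \<omega>) - mean_grad grad \<DD> t \<omega> (y \<omega>)))\<^sup>2 \<partial>\<DD> t \<omega>)"
      unfolding \<psi>_def using grad_diff_mean_grad(2)[OF t \<omega> y(2)[OF \<omega>]]
      by (simp add: nn_integral_eq_integral)
    also have "\<dots> \<le> ennreal (grad_variance X grad \<DD> t \<omega>)"
      using grad_variance_bounds(1)[OF t \<omega> y(2)[OF \<omega>]] by (rule ennreal_leI)
    finally show "(\<integral>\<^sup>+h. \<psi> (h, y \<omega>, mean_grad grad \<DD> t \<omega> (y \<omega>)) \<partial>\<DD> t \<omega>) \<le> grad_variance X grad \<DD> t \<omega>" .
  qed
  also have "\<dots> = ennreal (expectation (grad_variance X grad \<DD> t))"
    using grad_variance_bounds(2)[OF t] integrable_grad_variance[OF t]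
    by (intro nn_integral_eq_integral) auto
  finally show "expectation e \<le> expectation (grad_variance X grad \<DD> t)"
    using grad_variance_bounds(2)[OF t] by (simp add: integral_nonneg_AE)
qed

end

section \<open>Expected regret\<close>

lemma ln_le_tangent:
  assumes "0 < z" "0 < (a::real)"
  shows "ln z \<le> ln a + (z - a) / a"
proof -
  have "ln (z / a) \<le> z / a - 1" using assms by (intro ln_le_minus_one) simp
  then show ?thesis using assms by (simp add: ln_div diff_divide_distrib)
qed

lemma regret_const_bound:
  fixes n S S' :: real
  assumes pos: "G > 0" "D > 0" "L > 0" "\<alpha> > 0" and "n \<ge> 1" "S \<ge> 0" "S' \<ge> 0"
    and \<beta>: "\<beta> = beta_of D G \<alpha>"
  shows "16 * n / \<beta> * ln (\<beta> / n * S + \<beta> / (2 * n) * S' + \<beta> / (8 * n) * G\<^sup>2 + 1)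
      + 16 * n / \<beta> * ln (32 * L\<^sup>2 + 1) + D\<^sup>2 * (1 + \<beta> / 2 * G\<^sup>2)
    \<le> regret_const D G L \<alpha> * (n / \<alpha>) * (1 + ln (1 + S + S'))"
proof -
  have b: "\<beta> > 0" using beta_of_bounds(1)[OF pos(1,2,4)] \<beta> by simp
  define c where "c = 1 + \<beta> + \<beta> / 8 * G\<^sup>2"
  define K where "K = D\<^sup>2 * (1 + \<beta> / 2 * G\<^sup>2)"
  define \<Lambda> where "\<Lambda> = ln (1 + S + S')"
  define k where "k = ln (32 * L\<^sup>2 + 1)"
  have c: "c \<ge> 1" using b by (simp add: c_def)
  have nn: "\<Lambda> \<ge> 0" "k \<ge> 0" "ln c \<ge> 0" "K \<ge> 0"
    using assms b c by (auto simp: \<Lambda>_def k_def K_def)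
  have "\<beta> / n * S + \<beta> / (2 * n) * S' + \<beta> / (8 * n) * G\<^sup>2 + 1 \<le> \<beta> * S + \<beta> * S' + \<beta> / 8 * G\<^sup>2 + 1"
    using assms b by (intro add_mono mult_right_mono) (auto simp: divide_le_eq mult_le_cancel_left1)
  \<comment> \<open>The added nonnegative terms complete the product
    \<open>c * (1 + S + S')\<close>, whose logarithm splits.\<close>
  also have "\<dots> \<le> (\<beta> * S + \<beta> * S' + \<beta> / 8 * G\<^sup>2 + 1) + (S + S' + \<beta> + \<beta> / 8 * G\<^sup>2 * (S + S'))"
    using assms(6,7) b by simp
  also have "\<dots> = c * (1 + S + S')" by (simp add: c_def algebra_simps)
  finally have "ln (\<beta> / n * S + \<beta> / (2 * n) * S' + \<beta> / (8 * n) * G\<^sup>2 + 1) \<le> ln (c * (1 + S + S'))"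
    using assms b by (intro ln_mono) (auto intro!: add_nonneg_pos add_nonneg_nonneg)
  also have "\<dots> = ln c + \<Lambda>" using c assms by (simp add: ln_mult \<Lambda>_def)
  finally have "16 * n / \<beta> * ln (\<beta> / n * S + \<beta> / (2 * n) * S' + \<beta> / (8 * n) * G\<^sup>2 + 1)
      \<le> 16 * n / \<beta> * (ln c + \<Lambda>)"
    using assms b by (intro mult_left_mono) auto
  moreover have "16 * n / \<beta> * (ln c + \<Lambda> + k) \<le> 16 * n / \<beta> * ((1 + ln c + k) * (1 + \<Lambda>))"
    using assms b nn by (intro mult_left_mono) (auto simp: algebra_simps)
  moreover have "K \<le> n * K * (1 + \<Lambda>)"
    using mult_mono[of 1 n K "K * (1 + \<Lambda>)"] nn \<open>n \<ge> 1\<close> by (simp add: mult_le_cancel_left1 mult.assoc)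
  moreover have "regret_const D G L \<alpha> * (n / \<alpha>) * (1 + \<Lambda>)
      = 16 * n / \<beta> * ((1 + ln c + k) * (1 + \<Lambda>)) + n * K * (1 + \<Lambda>)"
    using pos unfolding regret_const_def Let_def \<beta>[symmetric]
    by (simp add: c_def k_def K_def field_simps)
  ultimately show ?thesis unfolding \<Lambda>_def k_def K_def by (simp add: distrib_left)
qed

theorem theorem5:
  fixes M :: "'w measure"
    and T :: nat
    and X :: "(real ^ 'd) set"
    and N :: "(real ^ 'd \<Rightarrow> real) measure"
    and grad :: "(real ^ 'd \<Rightarrow> real) \<Rightarrow> real ^ 'd \<Rightarrow> real ^ 'd"
    and \<DD> :: "nat \<Rightarrow> 'w \<Rightarrow> (real ^ 'd \<Rightarrow> real) measure"
    and f :: "nat \<Rightarrow> 'w \<Rightarrow> real ^ 'd \<Rightarrow> real"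
    and G D L \<alpha> \<beta> \<sigma>2 \<Sigma>2 d :: real
    and x1 u :: "real ^ 'd"
    and x xh :: "nat \<Rightarrow> 'w \<Rightarrow> real ^ 'd"
  assumes model: "sea_model M T X N grad \<DD> f"
    and pos: "G > 0" "D > 0" "L > 0" "\<alpha> > 0"
    and grad_bound:
      "\<And>t \<omega> y. t \<in> {1..T} \<Longrightarrow> \<omega> \<in> space M \<Longrightarrow> y \<in> X \<Longrightarrow> norm (grad (f t \<omega>) y) \<le> G"
      "\<And>t \<omega>. t \<in> {1..T} \<Longrightarrow> \<omega> \<in> space M \<Longrightarrow> AE h in \<DD> t \<omega>. \<forall>y\<in>X. norm (grad h y) \<le> G"
    and zero_mem: "0 \<in> X"
    and diameter: "\<And>y z. y \<in> X \<Longrightarrow> z \<in> X \<Longrightarrow> norm (y - z) \<le> D"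
    and smooth: "\<And>t \<omega> y z. t \<in> {1..T} \<Longrightarrow> \<omega> \<in> space M \<Longrightarrow> y \<in> X \<Longrightarrow> z \<in> X \<Longrightarrow>
      norm (grad (mean_fun (\<DD> t \<omega>)) y - grad (mean_fun (\<DD> t \<omega>)) z) \<le> L * norm (y - z)"
    and exp_concave: "\<And>t \<omega>. t \<in> {1..T} \<Longrightarrow> \<omega> \<in> space M \<Longrightarrow> exp_concave_on \<alpha> X (f t \<omega>)"
    and beta: "\<beta> = beta_of D G \<alpha>"
    and init: "x1 \<in> X"
    and run: "\<And>\<omega>. \<omega> \<in> space M \<Longrightarrow>
      oomd_run T X grad \<beta> G x1 (\<lambda>t. f t \<omega>) (\<lambda>t. x t \<omega>) (\<lambda>t. xh t \<omega>)"
    and comparator: "u \<in> X"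
    and sigma2: "\<sigma>2 = cum_variance M T X grad \<DD>"
    and Sigma2: "\<Sigma>2 = cum_variation M T X grad \<DD>"
    and dim: "d = real CARD('d)"
  shows "(\<integral>\<omega>. ((\<Sum>t=1..T. f t \<omega> (x t \<omega>)) - (\<Sum>t=1..T. f t \<omega> u)) \<partial>M)
      \<le> 16 * d / \<beta> * ln (\<beta> / d * \<sigma>2 + \<beta> / (2 * d) * \<Sigma>2 + \<beta> / (8 * d) * G\<^sup>2 + 1)
        + 16 * d / \<beta> * ln (32 * L\<^sup>2 + 1) + D\<^sup>2 * (1 + \<beta> / 2 * G\<^sup>2)
    \<and> (\<integral>\<omega>. ((\<Sum>t=1..T. f t \<omega> (x t \<omega>)) - (\<Sum>t=1..T. f t \<omega> u)) \<partial>M)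
      \<le> regret_const D G L \<alpha> * (d / \<alpha>) * (1 + ln (1 + \<sigma>2 + \<Sigma>2))"
proof -
  have bdd: "sea_model_bounded_grad M T X N grad \<DD> f G"
    using model grad_bound(2) pos(1) by (simp add: sea_model_bounded_grad_def sea_model_bounded_grad_axioms_def)
  interpret sea_model_bounded_grad M T X N grad \<DD> f G by (rule bdd)
  note b = beta_of_bounds[OF pos(1,2,4), folded beta]
  have n: "d \<ge> 1" by (simp add: dim Suc_leI)
  have "compact X"
    using diameter[OF _ zero_mem] domain(2) by (auto simp: compact_eq_bounded_closed bounded_iff)
  have mem: "x t \<omega> \<in> X" if "t \<in> {1..T}" "\<omega> \<in> space M" for t \<omega>
    using oomd_run_mem(1)[OF run[OF that(2)] init] that(1) by auto
  define e where "e t \<omega> = (norm (grad (f t \<omega>) (x t \<omega>) - mean_grad grad \<DD> t \<omega> (x t \<omega>)))\<^sup>2" for t \<omega>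
  have e: "integrable M (e t)" "expectation (e t) \<le> expectation (grad_variance X grad \<DD> t)" if "t \<in> {1..T}" for t
  proof -
    have "x t \<in> borel_measurable (\<F> t)"
      using oomd_run_measurable_past(1)[OF \<open>compact X\<close> init _ run that, of t] b(1) that by auto
    then show "integrable M (e t)" "expectation (e t) \<le> expectation (grad_variance X grad \<DD> t)"
      unfolding e_def using gradient_noise[OF that, of "x t"] mem[OF that] grad_bound(1)[OF that] by auto
  qed
  define A where "A \<omega> = \<beta> / d * (\<Sum>t=1..T. e t \<omega>) + \<beta> / (2 * d) * (\<Sum>t=1..T. grad_variation X grad \<DD> t \<omega>)
      + \<beta> / (8 * d) * G\<^sup>2 + 1" for \<omega>
  define a where "a = \<beta> / d * \<sigma>2 + \<beta> / (2 * d) * \<Sigma>2 + \<beta> / (8 * d) * G\<^sup>2 + 1"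
  define K where "K = 16 * d / \<beta> * ln (32 * L\<^sup>2 + 1) + D\<^sup>2 * (1 + \<beta> / 2 * G\<^sup>2)"
  define R where "R \<omega> = (\<Sum>t=1..T. f t \<omega> (x t \<omega>)) - (\<Sum>t=1..T. f t \<omega> u)" for \<omega>
  have nonneg: "\<sigma>2 \<ge> 0" "\<Sigma>2 \<ge> 0"
    unfolding sigma2 Sigma2 cum_variance_def cum_variation_def
    by (auto intro!: integral_nonneg_AE AE_I2 sum_nonneg grad_variance_bounds(2) grad_variation_bounds(2))
  have a: "a \<ge> 1" unfolding a_def using nonneg n b(1)
    by (auto intro!: add_nonneg_nonneg divide_nonneg_pos mult_nonneg_nonneg)
  have K: "K \<ge> 0" unfolding K_def using n b(1) by (auto intro!: add_nonneg_nonneg mult_nonneg_nonneg)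
  \<comment> \<open>The tangent is taken at \<open>a\<close>, an upper bound for the expectation of
    \<open>A\<close>, so the linear term has nonpositive expectation.\<close>
  have path: "R \<omega> \<le> 16 * d / \<beta> * (ln a + (A \<omega> - a) / a) + K" if \<omega>: "\<omega> \<in> space M" for \<omega>
  proof -
    have "R \<omega> = (\<Sum>t=1..T. f t \<omega> (x t \<omega>) - f t \<omega> u)" by (simp add: R_def sum_subtractf)
    also have "\<dots> \<le> 16 * d / \<beta> * ln (A \<omega>) + K"
      unfolding A_def K_def e_def dim add.assoc[symmetric]
    proof (rule oomd_regret_variation[OF run[OF \<omega>] horizon domain(3) comparator init])
      show "norm (u - x1) \<le> D" by (rule diameter[OF comparator init])
      fix t assume t: "t \<in> {1..T}"
      show "norm (grad (f t \<omega>) (x t \<omega>)) \<le> G" by (rule grad_bound(1)[OF t \<omega> mem[OF t \<omega>]])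
      then show "f t \<omega> (x t \<omega>) - f t \<omega> u \<le> grad (f t \<omega>) (x t \<omega>) \<bullet> (x t \<omega> - u)
          - \<beta> / 2 * (grad (f t \<omega>) (x t \<omega>) \<bullet> (x t \<omega> - u))\<^sup>2"
        using exp_concave[OF t \<omega>] loss_gradient measurable_space[OF loss_measurable[OF t] \<omega>]
          mem[OF t \<omega>] comparator diameter pos beta
        by (intro exp_concave_on_quadratic_bound) auto
      show "norm (mean_grad grad \<DD> t \<omega> y - mean_grad grad \<DD> t \<omega> z) \<le> L * norm (y - z)"
        if "y \<in> X" "z \<in> X" for y z
        using smooth[OF t \<omega> that] t by (simp add: mean_grad_def)
      show "0 \<le> grad_variation X grad \<DD> t \<omega>" by (rule grad_variation_bounds(2)[OF t \<omega>])
    next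
      fix t y assume "t \<in> {2..T}" "y \<in> X"
      then show "(norm (mean_grad grad \<DD> t \<omega> y - mean_grad grad \<DD> (t - 1) \<omega> y))\<^sup>2 \<le> grad_variation X grad \<DD> t \<omega>"
        using \<omega> by (intro grad_variation_bounds(1)) auto
    qed (use b pos in auto)
    finally have *: "R \<omega> \<le> 16 * d / \<beta> * ln (A \<omega>) + K" .
    have "ln (A \<omega>) \<le> ln a + (A \<omega> - a) / a"
    proof (rule ln_le_tangent)
      show "0 < A \<omega>" unfolding A_def e_def using n b(1) grad_variation_bounds(2)[OF _ \<omega>]
        by (auto intro!: add_nonneg_pos add_nonneg_nonneg divide_nonneg_pos mult_nonneg_nonneg sum_nonneg)
    qed (use a in simp)
    then have "16 * d / \<beta> * ln (A \<omega>) \<le> 16 * d / \<beta> * (ln a + (A \<omega> - a) / a)"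
      using n b(1) by (intro mult_left_mono) auto
    with * show ?thesis by linarith
  qed
  have "expectation R \<le> 16 * d / \<beta> * ln a + K"
  proof (cases "integrable M R")
    case True
    define P where "P \<omega> = (\<Sum>t=1..T. e t \<omega>)" for \<omega>
    define Q where "Q \<omega> = (\<Sum>t=1..T. grad_variation X grad \<DD> t \<omega>)" for \<omega>
    have PQ: "integrable M P" "integrable M Q"
      unfolding P_def Q_def using e(1) integrable_grad_variation
      by (auto intro!: Bochner_Integration.integrable_sum)
    have A: "A \<omega> = \<beta> / d * P \<omega> + \<beta> / (2 * d) * Q \<omega> + \<beta> / (8 * d) * G\<^sup>2 + 1" for \<omega>
      by (simp add: A_def P_def Q_def)
    have intA: "integrable M A" unfolding A using PQ by simp
    have "expectation Q = \<Sigma>2" unfolding Q_def Sigma2 cum_variation_def ..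
    then have "expectation A = \<beta> / d * expectation P + \<beta> / (2 * d) * \<Sigma>2 + \<beta> / (8 * d) * G\<^sup>2 + 1"
      unfolding A using PQ by (simp add: prob_space)
    also have "expectation P = (\<Sum>t=1..T. expectation (e t))"
      unfolding P_def using e(1) by (intro Bochner_Integration.integral_sum) auto
    also have "\<dots> \<le> (\<Sum>t=1..T. expectation (grad_variance X grad \<DD> t))"
      using e(2) by (intro sum_mono) auto
    also have "\<dots> = \<sigma>2"
      unfolding sigma2 cum_variance_def using integrable_grad_variance
      by (intro Bochner_Integration.integral_sum[symmetric]) auto
    finally have "expectation A \<le> a" using n b(1) by (simp add: a_def mult_left_mono divide_right_mono)
    have "expectation R \<le> expectation (\<lambda>\<omega>. 16 * d / \<beta> * (ln a + (A \<omega> - a) / a) + K)"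
      using True intA path by (intro integral_mono) auto
    also have "\<dots> = 16 * d / \<beta> * (ln a + (expectation A - a) / a) + K"
      using intA by (simp add: prob_space)
    also have "\<dots> \<le> 16 * d / \<beta> * ln a + K"
      using \<open>expectation A \<le> a\<close> a n b(1)
      by (intro add_right_mono mult_left_mono) (auto simp: divide_nonpos_pos)
    finally show ?thesis .
  \<comment> \<open>The Bochner integral of a non-integrable function is 0, while the bound is
    nonnegative because \<open>a\<close> is at least 1.\<close>
  next
    case False
    then show ?thesis using a n b(1) K by (simp add: not_integrable_integral_eq)
  qed
  then have "expectation R \<le> 16 * d / \<beta> * ln a + 16 * d / \<beta> * ln (32 * L\<^sup>2 + 1) + D\<^sup>2 * (1 + \<beta> / 2 * G\<^sup>2)"
    by (simp add: K_def)
  then show ?thesis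
    using regret_const_bound[OF pos n nonneg beta] unfolding R_def a_def by (meson order_trans)
qed

end
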